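(* Let $J$ be a finite positive integer and let $\{Q(t):t\ge 0\}$ be an irreducible continuous-time birth--death Markov chain on $\mathbb{J}=\{0,1,\ldots,J\}$ with birth rates $\lambda_0,\ldots,\lambda_J$ and death rates $\mu_0,\ldots,\mu_J$, where $\lambda_J=\mu_0=0$ and all other rates are positive, and let $Q(0)$ have an arbitrary distribution on $\mathbb{J}$. Let $\{q_j^+\}_{j\in\mathbb{J}}$ and $\{q_j^-\}_{j\in\mathbb{J}}$ be constants in $[0,1]$ with $q_0^-=0$, $q_J^+=0$, and with at least one of these constants positive. Let $N_q$ be the thinned counting process of births and deaths of $Q$ (defined in the context), and let $\pi_k$, $P_k$, $\overline{\lambda}$, $\Lambda_k$ be as in the context. Then the asymptotic index of dispersion $$\mathcal{D}:=\lim_{t\to\infty}\frac{\operatorname{var} N_q(0,t]}{\mathbb{E}\big[N_q(0,t]\big]}$$ exists and is given by $$\mathcal{D}=1+2\sum_{k=0}^{J-1}R_k,\qquad R_k=(P_k-\Lambda_k)\left(\frac{\overline{\lambda}\,(P_k-\Lambda_k)}{\pi_k\lambda_k}+q_k^+-q_{k+1}^-\right).$$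
   Context: Thinned process. $Q$ has right-continuous paths. Let $N_+$ and $N_-$ be the counting measures with unit atoms at the instants of births (jumps $+1$) and deaths (jumps $-1$) of $Q$ respectively, so $Q(t)=Q(0)+N_+(0,t]-N_-(0,t]$. For each atom $s$ of $N_+$ let $\tilde J^+(s)=1$ with probability $q^+_{Q(s^-)}$ and $\tilde J^+(s)=0$ otherwise; for each atom $s$ of $N_-$ let $\tilde J^-(s)=1$ with probability $q^-_{Q(s^-)}$ and $\tilde J^-(s)=0$ otherwise, where $Q(s^-)$ is the state just before the jump. Conditional on $\{Q(u):u<t'\}$, for any finite $t'$, all the indicators $\tilde J^{\pm}(t)$ with $t<t'$ are mutually independent. Define $$N_q(0,t]=\int_0^t\tilde J^+(u)\,N_+(\mathrm{d}u)+\int_0^t\tilde J^-(u)\,N_-(\mathrm{d}u),$$ i.e. the number of births and deaths in $(0,t]$ whose indicator equals $1$. Notation. The stationary probabilities of $Q$ are $$\pi_i=\pi_0\prod_{k=1}^i\frac{\lambda_{k-1}}{\mu_k},\quad i\in\mathbb{J},\qquad \sum_{i\in\mathbb{J}}\pi_i=1$$ (empty products equal $1$), and $P_k=\sum_{i=0}^k\pi_i$ for $k\in\mathbb{J}$. The thinned rate is $$\overline{\lambda}=\sum_{i\in\mathbb{J}}\pi_i(\lambda_iq_i^++\mu_iq_i^-),$$ and, for $k\in\mathbb{J}$, $$\Lambda_k=\frac{1}{\overline{\lambda}}\left(\sum_{i=0}^k\pi_i\lambda_iq_i^++\sum_{i=1}^k\pi_i\mu_iq_i^-\right)=\frac{1}{\overline{\lambda}}\left(\pi_k\lambda_kq_k^++\sum_{i=0}^{k-1}\pi_i\lambda_i(q_i^++q_{i+1}^-)\right).$$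 *)

theory Defs
  imports "HOL-Probability.Probability"
begin

section \<open>Continuous-time Markov chains on a finite set of naturals\<close>

definition transition_function :: "nat set \<Rightarrow> (real \<Rightarrow> nat \<Rightarrow> nat \<Rightarrow> real) \<Rightarrow> bool" where
  "transition_function S p \<longleftrightarrow>
     (\<forall>t\<ge>0. \<forall>i\<in>S. \<forall>j\<in>S. 0 \<le> p t i j) \<and>
     (\<forall>t\<ge>0. \<forall>i\<in>S. (\<Sum>j\<in>S. p t i j) = 1) \<and>
     (\<forall>i\<in>S. \<forall>j\<in>S. p 0 i j = (if i = j then 1 else 0)) \<and>
     (\<forall>s\<ge>0. \<forall>t\<ge>0. \<forall>i\<in>S. \<forall>j\<in>S. p (s + t) i j = (\<Sum>k\<in>S. p s i k * p t k j))"

text \<open>The law of \<open>Q 0\<close> is unconstrained. Left limits are part of the path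
  condition because the jumps of the path are to be counted together with the state just
  before each of them; with values in a discrete space, right-continuity and left limits make every
  path a step function with finitely many jumps in each bounded time interval. The values
  of \<open>Q\<close> at negative times play no role.\<close>

definition markov_chain ::
  "'a measure \<Rightarrow> nat set \<Rightarrow> (real \<Rightarrow> nat \<Rightarrow> nat \<Rightarrow> real) \<Rightarrow> (real \<Rightarrow> 'a \<Rightarrow> nat) \<Rightarrow> bool" where
  "markov_chain M S p Q \<longleftrightarrow>
     prob_space M \<and> transition_function S p \<and>
     (\<forall>t\<ge>0. Q t \<in> M \<rightarrow>\<^sub>M count_space UNIV) \<and>
     (\<forall>\<omega>\<in>space M. \<forall>t\<ge>0. Q t \<omega> \<in> S) \<and>
     (\<forall>\<omega>\<in>space M. \<forall>t\<ge>0. continuous (at_right t) (\<lambda>s. Q s \<omega>)) \<and>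
     (\<forall>\<omega>\<in>space M. \<forall>t>0. \<exists>l. ((\<lambda>s. Q s \<omega>) \<longlongrightarrow> l) (at_left t)) \<and>
     (\<forall>(n::nat) s x. \<forall>h\<ge>0. \<forall>j\<in>S.
        0 \<le> s 0 \<longrightarrow> (\<forall>k<n. s k < s (Suc k)) \<longrightarrow>
        0 < \<P>(\<omega> in M. \<forall>k\<le>n. Q (s k) \<omega> = x k) \<longrightarrow>
        \<P>(\<omega> in M. Q (s n + h) \<omega> = j \<bar> \<forall>k\<le>n. Q (s k) \<omega> = x k) = p h (x n) j)"

definition irreducible_chain :: "nat set \<Rightarrow> (real \<Rightarrow> nat \<Rightarrow> nat \<Rightarrow> real) \<Rightarrow> bool" where
  "irreducible_chain S p \<longleftrightarrow> (\<forall>i\<in>S. \<forall>j\<in>S. \<exists>t\<ge>0. 0 < p t i j)"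

definition birth_death_generator ::
  "(nat \<Rightarrow> real) \<Rightarrow> (nat \<Rightarrow> real) \<Rightarrow> nat \<Rightarrow> nat \<Rightarrow> real" where
  "birth_death_generator lam mu i j =
     (if j = Suc i then lam i
      else if i = Suc j then mu i
      else if i = j then - (lam i + mu i)
      else 0)"

definition birth_death_chain ::
  "'a measure \<Rightarrow> nat \<Rightarrow> (nat \<Rightarrow> real) \<Rightarrow> (nat \<Rightarrow> real) \<Rightarrow> (real \<Rightarrow> nat \<Rightarrow> nat \<Rightarrow> real)
     \<Rightarrow> (real \<Rightarrow> 'a \<Rightarrow> nat) \<Rightarrow> bool" where
  "birth_death_chain M J lam mu p Q \<longleftrightarrow>
     markov_chain M {..J} p Q \<and>
     (\<forall>i\<le>J. \<forall>j\<le>J. ((\<lambda>h. p h i j) has_real_derivative birth_death_generator lam mu i j)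
        (at 0 within {0..}))"


section \<open>Births and deaths of a path\<close>

definition left_state :: "(real \<Rightarrow> nat) \<Rightarrow> real \<Rightarrow> nat" where
  "left_state x s = Lim (at_left s) x"

definition births :: "(real \<Rightarrow> nat) \<Rightarrow> real set" where
  "births x = {s. 0 < s \<and> x s = left_state x s + 1}"

definition deaths :: "(real \<Rightarrow> nat) \<Rightarrow> real set" where
  "deaths x = {s. 0 < s \<and> x s + 1 = left_state x s}"

definition events_before :: "(real \<Rightarrow> nat) \<Rightarrow> real \<Rightarrow> real set" where
  "events_before x t = (births x \<union> deaths x) \<inter> {0<..<t}"

text \<open>Births and deaths are enumerated jointly in order of time, starting with index 0.
  The value is meaningful only if the path has more than \<open>k\<close> births and deaths.\<close>

definition event_time :: "(real \<Rightarrow> nat) \<Rightarrow> nat \<Rightarrow> real" where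
  "event_time x k = (THE s. s \<in> births x \<union> deaths x \<and> card (events_before x s) = k)"


section \<open>Thinning\<close>

definition cond_indep_vars ::
  "'a measure \<Rightarrow> 'a measure \<Rightarrow> ('i \<Rightarrow> 'b measure) \<Rightarrow> ('i \<Rightarrow> 'a \<Rightarrow> 'b) \<Rightarrow> 'i set \<Rightarrow> bool" where
  "cond_indep_vars M F M' X I \<longleftrightarrow>
     (\<forall>i\<in>I. X i \<in> M \<rightarrow>\<^sub>M M' i) \<and>
     (\<forall>K A. finite K \<longrightarrow> K \<subseteq> I \<longrightarrow> (\<forall>i\<in>K. A i \<in> sets (M' i)) \<longrightarrow>
        (AE \<omega> in M.
           real_cond_exp M F (indicator {\<omega>\<in>space M. \<forall>i\<in>K. X i \<omega> \<in> A i}) \<omega> =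
           (\<Prod>i\<in>K. real_cond_exp M F (indicator {\<omega>\<in>space M. X i \<omega> \<in> A i}) \<omega>)))"

definition strict_past :: "'a measure \<Rightarrow> (real \<Rightarrow> 'a \<Rightarrow> nat) \<Rightarrow> real \<Rightarrow> 'a measure" where
  "strict_past M Q t = sigma (space M) {Q u -` A \<inter> space M |u A. 0 \<le> u \<and> u < t}"

definition thinning_prob ::
  "(nat \<Rightarrow> real) \<Rightarrow> (nat \<Rightarrow> real) \<Rightarrow> (real \<Rightarrow> nat) \<Rightarrow> real \<Rightarrow> real" where
  "thinning_prob qp qm x s =
     (if s \<in> births x then qp (left_state x s) else qm (left_state x s))"

text \<open>The indicator attached to the event number \<open>k\<close> of the path, seen at time \<open>t\<close>. It is
  set to \<open>False\<close> when that event has not occurred before \<open>t\<close>. Whether it has occurred is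
  determined by the strict past of \<open>t\<close>, so conditionally on this past the dummy value is a
  constant and does not affect independence.\<close>

definition mark_before ::
  "(real \<Rightarrow> 'a \<Rightarrow> nat) \<Rightarrow> (real \<Rightarrow> 'a \<Rightarrow> bool) \<Rightarrow> (real \<Rightarrow> 'a \<Rightarrow> bool) \<Rightarrow> real \<Rightarrow> nat \<Rightarrow> 'a \<Rightarrow> bool" where
  "mark_before Q Jp Jm t k \<omega> \<longleftrightarrow>
     (let x = (\<lambda>s. Q s \<omega>); s = event_time x k in
        k < card (events_before x t) \<and> (if s \<in> births x then Jp s \<omega> else Jm s \<omega>))"

text \<open>\<open>Jp s\<close> and \<open>Jm s\<close> are constrained only at the births and at the deaths, respectively.\<close>

definition thinning_marks ::
  "'a measure \<Rightarrow> (real \<Rightarrow> 'a \<Rightarrow> nat) \<Rightarrow> (nat \<Rightarrow> real) \<Rightarrow> (nat \<Rightarrow> real)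
     \<Rightarrow> (real \<Rightarrow> 'a \<Rightarrow> bool) \<Rightarrow> (real \<Rightarrow> 'a \<Rightarrow> bool) \<Rightarrow> bool" where
  "thinning_marks M Q qp qm Jp Jm \<longleftrightarrow>
     (\<forall>t>0.
        cond_indep_vars M (strict_past M Q t) (\<lambda>_. count_space UNIV)
          (mark_before Q Jp Jm t) UNIV \<and>
        (\<forall>k. AE \<omega> in M. k < card (events_before (\<lambda>s. Q s \<omega>) t) \<longrightarrow>
           real_cond_exp M (strict_past M Q t)
             (indicator {\<omega>\<in>space M. mark_before Q Jp Jm t k \<omega>}) \<omega> =
           thinning_prob qp qm (\<lambda>s. Q s \<omega>) (event_time (\<lambda>s. Q s \<omega>) k)))"

text \<open>The number of births and deaths in \<open>(0, t]\<close> whose indicator equals 1.\<close>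

definition thinned_count ::
  "(real \<Rightarrow> 'a \<Rightarrow> nat) \<Rightarrow> (real \<Rightarrow> 'a \<Rightarrow> bool) \<Rightarrow> (real \<Rightarrow> 'a \<Rightarrow> bool) \<Rightarrow> real \<Rightarrow> 'a \<Rightarrow> real" where
  "thinned_count Q Jp Jm t \<omega> =
     (\<Sum>s\<in>births (\<lambda>u. Q u \<omega>) \<inter> {0<..t}. of_bool (Jp s \<omega>)) +
     (\<Sum>s\<in>deaths (\<lambda>u. Q u \<omega>) \<inter> {0<..t}. of_bool (Jm s \<omega>))"


section \<open>Quantities in the formula\<close>

text \<open>The product form of the stationary law of a birth-death chain, together with its
  normalisation, which fixes \<open>st 0\<close>.\<close>

definition stationary_distribution ::
  "nat \<Rightarrow> (nat \<Rightarrow> real) \<Rightarrow> (nat \<Rightarrow> real) \<Rightarrow> (nat \<Rightarrow> real) \<Rightarrow> bool" where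
  "stationary_distribution J lam mu st \<longleftrightarrow>
     (\<forall>i\<le>J. st i = st 0 * (\<Prod>k=1..i. lam (k - 1) / mu k)) \<and> (\<Sum>i\<le>J. st i) = 1"

definition cumulative :: "(nat \<Rightarrow> real) \<Rightarrow> nat \<Rightarrow> real" where
  "cumulative st k = (\<Sum>i\<le>k. st i)"

definition thinned_rate ::
  "nat \<Rightarrow> (nat \<Rightarrow> real) \<Rightarrow> (nat \<Rightarrow> real) \<Rightarrow> (nat \<Rightarrow> real) \<Rightarrow> (nat \<Rightarrow> real) \<Rightarrow> (nat \<Rightarrow> real) \<Rightarrow> real" where
  "thinned_rate J lam mu qp qm st = (\<Sum>i\<le>J. st i * (lam i * qp i + mu i * qm i))"

definition thinned_cumulative ::
  "nat \<Rightarrow> (nat \<Rightarrow> real) \<Rightarrow> (nat \<Rightarrow> real) \<Rightarrow> (nat \<Rightarrow> real) \<Rightarrow> (nat \<Rightarrow> real) \<Rightarrow> (nat \<Rightarrow> real) \<Rightarrow> nat \<Rightarrow> real" where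
  "thinned_cumulative J lam mu qp qm st k =
     ((\<Sum>i=0..k. st i * lam i * qp i) + (\<Sum>i=1..k. st i * mu i * qm i))
     / thinned_rate J lam mu qp qm st"

definition dispersion_term ::
  "nat \<Rightarrow> (nat \<Rightarrow> real) \<Rightarrow> (nat \<Rightarrow> real) \<Rightarrow> (nat \<Rightarrow> real) \<Rightarrow> (nat \<Rightarrow> real) \<Rightarrow> (nat \<Rightarrow> real) \<Rightarrow> nat \<Rightarrow> real" where
  "dispersion_term J lam mu qp qm st k =
     (let d = cumulative st k - thinned_cumulative J lam mu qp qm st k in
        d * (thinned_rate J lam mu qp qm st * d / (st k * lam k) + qp k - qm (k + 1)))"

end

theory Submission
  imports Defs
begin

text \<open>Given the path of the chain, the indicators are independent Bernoulli variables. Let \<open>A\<close>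
  be the sum of their success probabilities over the births and deaths in \<open>(0, t]\<close>, and
  \<open>B\<close> the sum of the squares of these probabilities. The thinned count \<open>N\<close> has conditional mean
  \<open>A\<close> and conditional variance \<open>A - B\<close>, so \<open>E N = E A\<close> and
  \<open>var N = var A + E A - E B\<close> (\<open>bernoulli_sum_moments\<close>, \<open>variance_thinned_count\<close>). Now
  \<open>A\<close> and \<open>B\<close> are functionals of the chain alone: they add up a function \<open>f i j\<close> over the
  jumps of the path from \<open>i\<close> to \<open>j\<close>.

  Such a functional \<open>X\<close> has two exact moment identities if its mean rate
  \<open>\<Sum>j. G i j * f i j\<close> is the same number \<open>c\<close> in every state \<open>i\<close>, namely
  \<open>E X = c t\<close>, and \<open>E (X - c t)\<^sup>2\<close> is the mean of the functional of \<open>f\<^sup>2\<close>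
  (\<open>expectation_jump_sum\<close>, \<open>expectation_jump_sum_centred_square\<close>). They are proved by observing the
  chain on a grid of mesh \<open>t / n\<close>. There the Markov property makes the compensated sum over the
  grid steps a martingale, and the derivative of the transition function at 0 turns the
  compensator into \<open>c t\<close> as the mesh tends to 0. Along each path the grid sums are eventually
  equal to the sum over the jumps, and they are dominated by the number of jumps, which is square
  integrable by the same martingale identity and Fatou's lemma.

  A general \<open>f\<close> is reduced to a constant rate by the Poisson equation. Replacing \<open>f i j\<close> by
  \<open>f i j + h j - h i\<close> changes the functional only by the bounded boundary term
  \<open>h (Q t) - h (Q 0)\<close>, and \<open>h\<close> can be chosen so that the new rate is its stationary mean in
  every state (\<open>poisson_equation\<close>). For a birth-death chain the increments \<open>d k\<close> of \<open>h\<close> are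
  explicit, and for the function defining \<open>A\<close> they are
  \<open>d k = L * (P k - \<Lambda> k) / (\<pi> k * \<lambda> k)\<close> with \<open>L\<close> the thinned rate
  (\<open>increment_mark_rate\<close>). The initial law influences only boundary terms.

  Hence \<open>E A / t\<close> tends to \<open>L\<close>, and \<open>var A / t\<close> and \<open>E B / t\<close> tend to the stationary mean
  rates of the squared jumps with and without the correction. In equilibrium the edge between
  \<open>k\<close> and \<open>k + 1\<close> is crossed at rate \<open>\<pi> k * \<lambda> k\<close> in either direction, with corrected
  jumps \<open>q\<^sup>+ k + d k\<close> and \<open>q\<^sup>- (k + 1) - d k\<close>. The squares of the \<open>q\<close> cancel between
  \<open>var A\<close> and \<open>E B\<close>, and what remains of \<open>(var A + E A - E B) / E A\<close> is
  \<open>1 + 2 * (\<Sum>k. \<pi> k * \<lambda> k * d k * (d k + q\<^sup>+ k - q\<^sup>- (k + 1))) / L\<close>, which is the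
  asserted formula (\<open>dispersion_formula\<close>).\<close>

section \<open>Step paths and their jumps\<close>

definition step_path :: "(real \<Rightarrow> nat) \<Rightarrow> bool" where
  "step_path x \<longleftrightarrow> (\<forall>t\<ge>0. continuous (at_right t) x) \<and> (\<forall>t>0. \<exists>l. (x \<longlongrightarrow> l) (at_left t))"

text \<open>Jumps of any size are recorded, because a grid notices every change of state. With them,
  a sum of increments \<open>h j - h i\<close> over the jumps telescopes on every path.\<close>

definition jumps :: "(real \<Rightarrow> nat) \<Rightarrow> real set" where
  "jumps x = {s. 0 < s \<and> x s \<noteq> left_state x s}"

definition jump_sum :: "(nat \<Rightarrow> nat \<Rightarrow> real) \<Rightarrow> (real \<Rightarrow> nat) \<Rightarrow> real \<Rightarrow> real" where
  "jump_sum f x t = (\<Sum>s\<in>jumps x \<inter> {0<..t}. f (left_state x s) (x s))"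

definition grid_sum :: "(nat \<Rightarrow> nat \<Rightarrow> real) \<Rightarrow> (real \<Rightarrow> nat) \<Rightarrow> real \<Rightarrow> nat \<Rightarrow> real" where
  "grid_sum f x t n = (\<Sum>m<n. f (x (t / n * m)) (x (t / n * Suc m)))"

lemma step_path_right:
  assumes "step_path x" "0 \<le> t"
  shows "eventually (\<lambda>s. x s = x t) (at_right t)"
  using assms by (auto simp: step_path_def continuous_within tendsto_discrete)

lemma step_path_left:
  assumes "step_path x" "0 < t"
  shows "eventually (\<lambda>s. x s = left_state x t) (at_left t)"
proof -
  obtain l where l: "(x \<longlongrightarrow> l) (at_left t)"
    using assms by (auto simp: step_path_def)
  then have "left_state x t = l"
    unfolding left_state_def by (intro tendsto_Lim) (simp_all add: trivial_limit_at_left_real)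
  with l show ?thesis by (simp add: tendsto_discrete)
qed

lemma step_path_left_witness:
  assumes x: "step_path x" and us: "0 < s" "u < s"
  obtains v where "x v = left_state x s" "u < v" "v < s"
proof -
  have "eventually (\<lambda>v. x v = left_state x s \<and> v \<in> {u<..<s}) (at_left s)"
    by (rule eventually_conj[OF step_path_left[OF x us(1)] eventually_at_left_real[OF us(2)]])
  then have "\<exists>v. x v = left_state x s \<and> v \<in> {u<..<s}"
    by (rule eventually_happens'[OF trivial_limit_at_left_real])
  with that show ?thesis by auto
qed

lemma step_path_constant:
  assumes x: "step_path x" and uv: "0 \<le> u" "u \<le> v" and nj: "jumps x \<inter> {u<..v} = {}"
  shows "x u = x v"
proof (cases "u < v")
  case True
  have "\<forall>a\<in>{u..v}. eventually (\<lambda>b. x a = x b) (at a within {u..v})"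
  proof
    fix a assume a: "a \<in> {u..v}"
    have r: "eventually (\<lambda>b. x a = x b) (at_right a)"
    proof (rule eventually_mono[OF step_path_right[OF x]])
      show "0 \<le> a" using a uv by auto
    qed simp
    show "eventually (\<lambda>b. x a = x b) (at a within {u..v})"
    proof (cases "a = u")
      case True
      then show ?thesis using r \<open>u < v\<close> by (simp add: at_within_Icc_at_right)
    next
      case False
      then have "a \<notin> jumps x" "0 < a" using a nj uv by auto
      then have "x a = left_state x a" by (simp add: jumps_def)
      then have "eventually (\<lambda>b. x a = x b) (at_left a)"
        by (intro eventually_mono[OF step_path_left[OF x \<open>0 < a\<close>]]) simp
      with r have "eventually (\<lambda>b. x a = x b) (at a)"
        by (simp add: eventually_at_split)
      then show ?thesis
        by (rule filter_leD[OF at_le[OF subset_UNIV]])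
    qed
  qed
  then show ?thesis
    by (intro connected_local_const[of "{u..v}" u v x]) (use uv in simp_all)
qed (use uv in auto)

lemma step_path_before_jump:
  assumes x: "step_path x" and us: "0 \<le> u" "u < s" and nj: "jumps x \<inter> {u<..<s} = {}"
  shows "x u = left_state x s"
proof -
  obtain v where v: "x v = left_state x s" "u < v" "v < s"
    using step_path_left_witness[OF x, of s u] us by auto
  then have "x u = x v"
    using us nj by (intro step_path_constant[OF x]) auto
  with v show ?thesis by simp
qed

text \<open>A point where jumps accumulate would violate the existence of one of the one-sided
  limits there, so compactness of the time interval leaves only finitely many jumps.\<close>

lemma finite_jumps:
  assumes x: "step_path x"
  shows "finite (jumps x \<inter> {0<..t})"
proof -
  have ev: "eventually (\<lambda>s. s \<notin> jumps x) (at_right a)" if "0 \<le> a" for a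
  proof -
    obtain b where b: "b > a" "\<And>y. a < y \<Longrightarrow> y < b \<Longrightarrow> x y = x a"
      using step_path_right[OF x \<open>0 \<le> a\<close>] by (auto simp: eventually_at_right_field)
    have "y \<notin> jumps x" if y: "a < y" "y < b" for y
    proof -
      have "0 < y" using y \<open>0 \<le> a\<close> by simp
      obtain v where v: "x v = left_state x y" "a < v" "v < y"
        using step_path_left_witness[OF x \<open>0 < y\<close> y(1)] by auto
      then have "left_state x y = x y" using b(2)[of v] b(2)[of y] y by simp
      then show ?thesis by (simp add: jumps_def)
    qed
    then show ?thesis using b(1) by (auto simp: eventually_at_right_field)
  qed
  have ev': "eventually (\<lambda>s. s \<notin> jumps x) (at_left a)" if "0 < a" for a
  proof -
    obtain b where b: "b < a" "\<And>y. b < y \<Longrightarrow> y < a \<Longrightarrow> x y = left_state x a"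
      using step_path_left[OF x \<open>0 < a\<close>] by (auto simp: eventually_at_left_field)
    have "y \<notin> jumps x" if y: "b < y" "y < a" for y
    proof
      assume "y \<in> jumps x"
      then have "0 < y" "x y \<noteq> left_state x y" by (auto simp: jumps_def)
      obtain v where v: "x v = left_state x y" "b < v" "v < y"
        using step_path_left_witness[OF x \<open>0 < y\<close> y(1)] by auto
      then have "left_state x y = x y" using b(2)[of v] b(2)[of y] y by simp
      with \<open>x y \<noteq> left_state x y\<close> show False by simp
    qed
    then show ?thesis using b(1) by (auto simp: eventually_at_left_field)
  qed
  have "\<not> a islimpt (jumps x \<inter> {0<..t})" if a: "a \<in> {0..t}" for a
  proof
    assume lim: "a islimpt (jumps x \<inter> {0<..t})"
    have "eventually (\<lambda>s. s \<notin> jumps x \<inter> {0<..t}) (at_left a)"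
    proof (cases "a = 0")
      case True
      then show ?thesis by (intro eventually_at_leftI[of "-1"]) auto
    next
      case False
      then show ?thesis using ev'[of a] a by (auto elim: eventually_mono)
    qed
    moreover have "eventually (\<lambda>s. s \<notin> jumps x \<inter> {0<..t}) (at_right a)"
      using ev[of a] a by (auto elim: eventually_mono)
    ultimately have "eventually (\<lambda>s. s \<notin> jumps x \<inter> {0<..t}) (at a)"
      by (simp add: eventually_at_split)
    with lim show False by (simp add: islimpt_iff_eventually)
  qed
  then have "finite ({0..t} \<inter> (jumps x \<inter> {0<..t}))"
    by (intro finite_not_islimpt_in_compact) auto
  moreover have "{0..t} \<inter> (jumps x \<inter> {0<..t}) = jumps x \<inter> {0<..t}" by auto
  ultimately show ?thesis by simp
qed

text \<open>The cells are open on the left and closed on the right, like the time interval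
  \<open>(0, t]\<close>, so that every jump up to time \<open>t\<close> lies in exactly one of them.\<close>

lemma grid_cell_cover:
  assumes t: "0 < t" and n: "0 < n"
  shows "(\<Union>m<n. {t / real n * m<..t / real n * Suc m}) = {0<..t}"
    and "m \<noteq> k \<Longrightarrow> {t / real n * m<..t / real n * Suc m} \<inter> {t / real n * k<..t / real n * Suc k} = {}"
proof -
  let ?d = "t / real n"
  have d: "0 < ?d" using assms by simp
  show "(\<Union>m<n. {?d * m<..?d * Suc m}) = {0<..t}"
  proof (intro equalityI subsetI)
    fix s assume "s \<in> (\<Union>m<n. {?d * m<..?d * Suc m})"
    then obtain m where m: "m < n" "?d * m < s" "s \<le> ?d * Suc m" by auto
    have "?d * Suc m \<le> ?d * n" using m(1) d by (intro mult_left_mono) auto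
    also have "\<dots> = t" using n by simp
    finally have "s \<le> t" using m by simp
    moreover have "0 \<le> ?d * m" using d by (intro mult_nonneg_nonneg) linarith+
    ultimately show "s \<in> {0<..t}" using m by auto
  next
    fix s assume s: "s \<in> {0<..t}"
    define c where "c = \<lceil>s / ?d\<rceil>"
    have "0 < s / ?d" using s d by (intro divide_pos_pos[OF _ d]) simp
    then have c0: "0 < c" by (simp add: c_def)
    have "s / ?d \<le> real n" using s n t by (simp add: field_simps)
    then have cn: "c \<le> int n" unfolding c_def by (simp add: ceiling_le_iff)
    define m where "m = nat (c - 1)"
    have cm: "real_of_int c = real m + 1" using c0 by (simp add: m_def)
    have "m < n" using c0 cn by (simp add: m_def)
    moreover have "real m < s / ?d" "s / ?d \<le> real (Suc m)"
      using cm unfolding c_def by linarith+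
    then have "?d * m < s" "s \<le> ?d * Suc m" using d n by (simp_all add: field_simps)
    ultimately show "s \<in> (\<Union>m<n. {?d * m<..?d * Suc m})" by auto
  qed
  have disj: "{?d * m<..?d * Suc m} \<inter> {?d * k<..?d * Suc k} = {}" if "m < k" for m k
  proof -
    have "?d * Suc m \<le> ?d * k" using that d by (intro mult_left_mono) auto
    then show ?thesis by auto
  qed
  show "{?d * m<..?d * Suc m} \<inter> {?d * k<..?d * Suc k} = {}" if "m \<noteq> k"
    using disj[of m k] disj[of k m] that by (cases "m < k") (simp_all only: Int_commute linorder_neq_iff, blast)
qed

lemma jump_sum_cells:
  assumes x: "step_path x" and t: "0 < t" and n: "0 < n"
  shows "jump_sum f x t =
    (\<Sum>m<n. \<Sum>s\<in>jumps x \<inter> {t / real n * m<..t / real n * Suc m}. f (left_state x s) (x s))"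
proof -
  let ?D = "\<lambda>m. jumps x \<inter> {t / real n * m<..t / real n * Suc m}"
  have eq: "jumps x \<inter> {0<..t} = (\<Union>m<n. ?D m)"
    using grid_cell_cover(1)[OF t n] by blast
  have "finite (\<Union>m<n. ?D m)"
    using finite_jumps[OF x, of t] unfolding eq .
  then have fin: "\<forall>m\<in>{..<n}. finite (?D m)"
    by (simp only: finite_UN finite_lessThan)
  have disj: "\<forall>m\<in>{..<n}. \<forall>k\<in>{..<n}. m \<noteq> k \<longrightarrow> ?D m \<inter> ?D k = {}"
    using grid_cell_cover(2)[OF t n] by blast
  show ?thesis
    unfolding jump_sum_def eq by (rule sum.UNION_disjoint[OF finite_lessThan fin disj])
qed

text \<open>A path whose values at the ends of a cell differ has jumped inside the cell, so a grid
  never sees more changes than there are jumps. This gives a bound that is uniform in the mesh.\<close>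

lemma abs_grid_sum_le:
  assumes x: "step_path x" and t: "0 < t" and n: "0 < n"
    and f0: "\<And>i. f i i = 0" and fC: "\<And>u v. 0 \<le> u \<Longrightarrow> 0 \<le> v \<Longrightarrow> \<bar>f (x u) (x v)\<bar> \<le> C"
  shows "\<bar>grid_sum f x t n\<bar> \<le> C * jump_sum (\<lambda>i j. 1) x t"
proof -
  let ?D = "\<lambda>m. jumps x \<inter> {t / real n * m<..t / real n * Suc m}"
  have d: "0 < t / real n" using t n by simp
  have C: "0 \<le> C" using fC[of 0 0] f0 by simp
  have "\<bar>grid_sum f x t n\<bar> \<le> (\<Sum>m<n. \<bar>f (x (t / n * m)) (x (t / n * Suc m))\<bar>)"
    unfolding grid_sum_def by (rule sum_abs)
  also have "\<dots> \<le> (\<Sum>m<n. C * (\<Sum>s\<in>?D m. 1))"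
  proof (rule sum_mono)
    fix m assume "m \<in> {..<n}"
    have le: "0 \<le> t / n * real m" using t by simp
    have le': "t / n * real m \<le> t / n * real (Suc m)" using d by (intro mult_left_mono) auto
    have fin: "finite (?D m)"
      using t n by (intro finite_subset[OF _ finite_jumps[OF x, of "t / real n * Suc m"]]) 
        (auto simp: jumps_def)
    show "\<bar>f (x (t / n * m)) (x (t / n * Suc m))\<bar> \<le> C * (\<Sum>s\<in>?D m. 1)"
    proof (cases "?D m = {}")
      case True
      have "x (t / n * m) = x (t / n * Suc m)"
        using True le le' by (intro step_path_constant[OF x])
      with f0 C show ?thesis by (simp add: sum_nonneg)
    next
      case False
      then have "1 \<le> card (?D m)" using fin by (simp add: Suc_leI card_gt_0_iff)
      then have "(1::real) \<le> (\<Sum>s\<in>?D m. 1)" by simp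
      then have "C * 1 \<le> C * (\<Sum>s\<in>?D m. 1)" using C by (intro mult_left_mono) 
      moreover have "\<bar>f (x (t / n * m)) (x (t / n * Suc m))\<bar> \<le> C" 
        using le le' by (intro fC) auto
      ultimately show ?thesis by linarith
    qed
  qed
  also have "\<dots> = C * jump_sum (\<lambda>i j. 1) x t"
    unfolding jump_sum_cells[OF x t n] by (simp add: sum_distrib_left)
  finally show ?thesis .
qed

text \<open>Once the mesh is below the smallest gap between jumps, every cell contains at most one
  jump, and the values at the ends of the cell are the states before and after it.\<close>

lemma eventually_grid_sum_eq_jump_sum:
  assumes x: "step_path x" and t: "0 < t" and f0: "\<And>i. f i i = 0"
  shows "eventually (\<lambda>n. grid_sum f x t n = jump_sum f x t) sequentially"
proof -
  let ?D = "jumps x \<inter> {0<..t}"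
  \<comment> \<open>The element 1 keeps the set of gaps nonempty when there is at most one jump.\<close>
  let ?G = "insert 1 ((\<lambda>(u, v). \<bar>u - v\<bar>) ` (?D \<times> ?D) - {0})"
  have finG: "finite ?G" using finite_jumps[OF x, of t] by simp
  define \<epsilon> where "\<epsilon> = Min ?G"
  have "\<epsilon> \<in> ?G" unfolding \<epsilon>_def using finG by (intro Min_in) auto
  then have e0: "0 < \<epsilon>" by auto
  have gap: "\<epsilon> \<le> \<bar>u - v\<bar>" if "u \<in> ?D" "v \<in> ?D" "u \<noteq> v" for u v
    unfolding \<epsilon>_def using that finG by (intro Min_le) auto
  have "((\<lambda>n. t / real n) \<longlongrightarrow> 0) sequentially" by (rule lim_const_over_n)
  then have "eventually (\<lambda>n. t / real n < \<epsilon>) sequentially"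
    using e0 by (rule order_tendstoD)
  then show ?thesis
    using eventually_gt_at_top[of 0]
  proof eventually_elim
    case (elim n)
    let ?C = "\<lambda>m. jumps x \<inter> {t / real n * m<..t / real n * Suc m}"
    have d: "0 < t / real n" using t elim by simp
    have cell: "f (x (t / n * m)) (x (t / n * Suc m)) = (\<Sum>s\<in>?C m. f (left_state x s) (x s))"
      if m: "m < n" for m
    proof -
      have step: "t / n * Suc m = t / n * m + t / n" by (simp add: distrib_left)
      have le: "0 \<le> t / n * real m" using t by simp
      have le': "t / n * real m \<le> t / n * real (Suc m)" using d by (intro mult_left_mono) auto
      have sub: "?C m \<subseteq> ?D" using grid_cell_cover(1)[OF t, of n] elim m by blast
      have one: "u = v" if "u \<in> ?C m" "v \<in> ?C m" for u v
      proof (rule ccontr)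
        assume "u \<noteq> v"
        then have "\<epsilon> \<le> \<bar>u - v\<bar>" using that sub by (intro gap) auto
        moreover have "\<bar>u - v\<bar> < t / n" using that step by auto
        ultimately show False using elim by simp
      qed
      show ?thesis
      proof (cases "?C m = {}")
        case True
        have "x (t / n * m) = x (t / n * Suc m)"
          using True le le' by (intro step_path_constant[OF x])
        with f0 show ?thesis unfolding True by simp
      next
        case False
        then obtain s where s: "s \<in> ?C m" by blast
        then have Cs: "?C m = {s}" using one by blast
        have "x (t / n * m) = left_state x s"
        proof (rule step_path_before_jump[OF x])
          have "jumps x \<inter> {t / n * m<..<s} \<subseteq> ?C m - {s}" using s by auto
          then show "jumps x \<inter> {t / n * m<..<s} = {}" unfolding Cs by simp
        qed (use s le in auto)
        moreover have "x s = x (t / n * Suc m)"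
        proof (rule step_path_constant[OF x])
          have "jumps x \<inter> {s<..t / n * Suc m} \<subseteq> ?C m - {s}" using s by auto
          then show "jumps x \<inter> {s<..t / n * Suc m} = {}" unfolding Cs by simp
        qed (use s in \<open>auto simp: jumps_def\<close>)
        ultimately show ?thesis unfolding Cs by simp
      qed
    qed
    show ?case
      unfolding jump_sum_cells[OF x t elim(2)] grid_sum_def using cell by (intro sum.cong) auto
  qed
qed

lemma grid_sum_tendsto_jump_sum:
  assumes "step_path x" "0 < t" "\<And>i. f i i = 0"
  shows "grid_sum f x t \<longlonglongrightarrow> jump_sum f x t"
  using eventually_grid_sum_eq_jump_sum[OF assms] by (rule tendsto_eventually)

lemma abs_jump_sum_le:
  assumes "step_path x" "0 < t" "\<And>i. f i i = 0"
    and "\<And>u v. 0 \<le> u \<Longrightarrow> 0 \<le> v \<Longrightarrow> \<bar>f (x u) (x v)\<bar> \<le> C"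
  shows "\<bar>jump_sum f x t\<bar> \<le> C * jump_sum (\<lambda>i j. 1) x t"
proof (rule tendsto_upperbound[OF tendsto_rabs[OF grid_sum_tendsto_jump_sum[OF assms(1-3)]]])
  show "eventually (\<lambda>n. \<bar>grid_sum f x t n\<bar> \<le> C * jump_sum (\<lambda>i j. 1) x t) sequentially"
    using eventually_gt_at_top[of 0] proof eventually_elim
    case (elim n)
    then show ?case by (intro abs_grid_sum_le assms)
  qed
qed simp

lemma jump_sum_offdiagonal:
  assumes "\<And>i j. i \<noteq> j \<Longrightarrow> f i j = g i j"
  shows "jump_sum f x t = jump_sum g x t"
  unfolding jump_sum_def by (intro sum.cong) (auto simp: jumps_def assms)

lemma measurable_two_states:
  assumes "X \<in> F \<rightarrow>\<^sub>M count_space UNIV" "Y \<in> F \<rightarrow>\<^sub>M count_space UNIV"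
  shows "(\<lambda>\<omega>. (f :: nat \<Rightarrow> nat \<Rightarrow> real) (X \<omega>) (Y \<omega>)) \<in> borel_measurable F"
proof (rule measurable_compose_countable[OF _ assms(1)])
  fix i
  have "f i \<in> count_space UNIV \<rightarrow>\<^sub>M borel" by simp
  then show "(\<lambda>\<omega>. f i (Y \<omega>)) \<in> borel_measurable F" by (rule measurable_compose[OF assms(2)])
qed

text \<open>The sigma-algebra is arbitrary so that the result applies to the strict past of a time after
  \<open>t\<close> as well as to the whole space.\<close>

lemma borel_measurable_jump_sum:
  assumes Q: "\<And>u. 0 \<le> u \<Longrightarrow> u \<le> t \<Longrightarrow> Q u \<in> F \<rightarrow>\<^sub>M count_space UNIV"
    and path: "\<And>\<omega>. \<omega> \<in> space F \<Longrightarrow> step_path (\<lambda>s. Q s \<omega>)"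
    and t: "0 < t" and f0: "\<And>i. f i i = 0"
  shows "(\<lambda>\<omega>. jump_sum f (\<lambda>s. Q s \<omega>) t) \<in> borel_measurable F"
proof (rule borel_measurable_LIMSEQ_real)
  fix \<omega> assume "\<omega> \<in> space F"
  then show "(\<lambda>n. grid_sum f (\<lambda>s. Q s \<omega>) t (Suc n)) \<longlonglongrightarrow> jump_sum f (\<lambda>s. Q s \<omega>) t"
    by (intro LIMSEQ_Suc grid_sum_tendsto_jump_sum path t f0)
next
  fix n
  show "(\<lambda>\<omega>. grid_sum f (\<lambda>s. Q s \<omega>) t (Suc n)) \<in> borel_measurable F"
    unfolding grid_sum_def
  proof (intro borel_measurable_sum measurable_two_states Q)
    fix m assume m: "m \<in> {..<Suc n}"
    have "t * real (Suc m) \<le> t * real (Suc n)" using t m by (intro mult_left_mono) auto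
    then show "t / real (Suc n) * real (Suc m) \<le> t" by (simp add: field_simps)
    have "t * real m \<le> t * real (Suc n)" using t m by (intro mult_left_mono) auto
    then show "t / real (Suc n) * real m \<le> t" by (simp add: field_simps)
  qed (use t in simp_all)
qed

section \<open>Square-integrable functionals of the jumps of a finite Markov chain\<close>

locale finite_markov_chain =
  fixes M :: "'a measure" and S :: "nat set" and p :: "real \<Rightarrow> nat \<Rightarrow> nat \<Rightarrow> real"
    and Q :: "real \<Rightarrow> 'a \<Rightarrow> nat" and G :: "nat \<Rightarrow> nat \<Rightarrow> real"
  assumes chain: "markov_chain M S p Q"
    and finite_S: "finite S"
    and generator: "\<And>i j. i \<in> S \<Longrightarrow> j \<in> S \<Longrightarrow>
      ((\<lambda>h. p h i j) has_real_derivative G i j) (at 0 within {0..})"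
begin

sublocale prob_space M
  using chain unfolding markov_chain_def by blast

lemma Q_measurable: "0 \<le> t \<Longrightarrow> Q t \<in> M \<rightarrow>\<^sub>M count_space UNIV"
  using chain unfolding markov_chain_def by blast

lemma Q_in_S: "\<omega> \<in> space M \<Longrightarrow> 0 \<le> t \<Longrightarrow> Q t \<omega> \<in> S"
  using chain unfolding markov_chain_def by blast

lemma step_path_Q: "\<omega> \<in> space M \<Longrightarrow> step_path (\<lambda>s. Q s \<omega>)"
  using chain unfolding markov_chain_def step_path_def by blast

lemma p_zero: "i \<in> S \<Longrightarrow> j \<in> S \<Longrightarrow> p 0 i j = (if i = j then 1 else 0)"
  using chain unfolding markov_chain_def transition_function_def by blast

lemma cylinder_measurable:
  fixes n :: nat
  assumes "\<And>k. k \<le> n \<Longrightarrow> 0 \<le> s k"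
  shows "{\<omega> \<in> space M. \<forall>k\<le>n. Q (s k) \<omega> = x k} \<in> events"
proof -
  have "{\<omega> \<in> space M. \<forall>k\<in>{..n}. Q (s k) \<omega> = x k} \<in> events"
  proof (rule sets.sets_Collect_finite_All')
    fix k assume "k \<in> {..n}"
    then have "0 \<le> s k" using assms by simp
    have "Q (s k) -` {x k} \<inter> space M \<in> events"
      by (rule measurable_sets[OF Q_measurable[OF \<open>0 \<le> s k\<close>]]) simp
    moreover have "Q (s k) -` {x k} \<inter> space M = {\<omega> \<in> space M. Q (s k) \<omega> = x k}" by auto
    ultimately show "{\<omega> \<in> space M. Q (s k) \<omega> = x k} \<in> events" by simp
  qed auto
  moreover have "{\<omega> \<in> space M. \<forall>k\<in>{..n}. Q (s k) \<omega> = x k} = {\<omega> \<in> space M. \<forall>k\<le>n. Q (s k) \<omega> = x k}"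
    by auto
  ultimately show ?thesis by (simp only:)
qed

text \<open>In product form the Markov property also covers null cylinders.\<close>

lemma prob_cylinder_step:
  assumes s: "0 \<le> s 0" "\<And>k. k < n \<Longrightarrow> s k < s (Suc k)" and h: "0 \<le> h" and j: "j \<in> S"
    and s0: "\<And>k. k \<le> n \<Longrightarrow> 0 \<le> s k"
  shows "prob {\<omega> \<in> space M. Q (s n + h) \<omega> = j \<and> (\<forall>k\<le>n. Q (s k) \<omega> = x k)} =
    prob {\<omega> \<in> space M. \<forall>k\<le>n. Q (s k) \<omega> = x k} * p h (x n) j"
proof (cases "prob {\<omega> \<in> space M. \<forall>k\<le>n. Q (s k) \<omega> = x k} = 0")
  case True
  have "prob {\<omega> \<in> space M. Q (s n + h) \<omega> = j \<and> (\<forall>k\<le>n. Q (s k) \<omega> = x k)}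
      \<le> prob {\<omega> \<in> space M. \<forall>k\<le>n. Q (s k) \<omega> = x k}"
    by (intro finite_measure_mono cylinder_measurable s0) auto
  with True show ?thesis by (simp add: measure_le_0_iff)
next
  case False
  then have pos: "0 < prob {\<omega> \<in> space M. \<forall>k\<le>n. Q (s k) \<omega> = x k}"
    by (simp add: zero_less_measure_iff)
  have "cond_prob M (\<lambda>\<omega>. Q (s n + h) \<omega> = j) (\<lambda>\<omega>. \<forall>k\<le>n. Q (s k) \<omega> = x k) = p h (x n) j"
    using chain s h j pos unfolding markov_chain_def by blast
  with False show ?thesis by (simp add: cond_prob_def field_simps)
qed

text \<open>A functional of finitely many states takes finitely many values and expands into cylinder
  indicators; this makes integrability automatic and reduces expectations to finite sums.\<close>

lemma
  fixes \<Phi> :: "(nat \<Rightarrow> nat) \<Rightarrow> real"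
  assumes s0: "\<And>k. k \<le> n \<Longrightarrow> 0 \<le> s k" and \<Phi>: "\<And>y. \<Phi> (restrict y {..n}) = \<Phi> y"
  shows integrable_cylinder: "integrable M (\<lambda>\<omega>. \<Phi> (\<lambda>k. Q (s k) \<omega>))"
    and expectation_cylinder: "expectation (\<lambda>\<omega>. \<Phi> (\<lambda>k. Q (s k) \<omega>)) =
      (\<Sum>x\<in>PiE {..n} (\<lambda>_. S). \<Phi> x * prob {\<omega> \<in> space M. \<forall>k\<le>n. Q (s k) \<omega> = x k})"
proof -
  let ?X = "PiE {..n} (\<lambda>_. S)"
  let ?C = "\<lambda>x. {\<omega> \<in> space M. \<forall>k\<le>n. Q (s k) \<omega> = x k}"
  have fin: "finite ?X" by (intro finite_PiE) (auto simp: finite_S)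
  have eq: "\<Phi> (\<lambda>k. Q (s k) \<omega>) = (\<Sum>x\<in>?X. \<Phi> x * indicator (?C x) \<omega>)" if \<omega>: "\<omega> \<in> space M" for \<omega>
  proof -
    define z where "z = restrict (\<lambda>k. Q (s k) \<omega>) {..n}"
    have z: "z \<in> ?X" using Q_in_S[OF \<omega>] s0 by (auto simp: z_def)
    have "\<omega> \<in> ?C x \<longleftrightarrow> x = z" if "x \<in> ?X" for x
      using that \<omega> z by (auto simp: z_def intro!: PiE_ext[OF that])
    then have "(\<Sum>x\<in>?X. \<Phi> x * indicator (?C x) \<omega>) = (\<Sum>x\<in>?X. if z = x then \<Phi> x else 0)"
      by (intro sum.cong) (auto simp: indicator_def simp del: mem_Collect_eq)
    also have "\<dots> = \<Phi> z" using fin z by simp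
    finally show ?thesis using \<Phi> by (simp add: z_def)
  qed
  have int: "integrable M (\<lambda>\<omega>. \<Phi> x * indicator (?C x) \<omega>)" for x
    by (intro integrable_mult_right integrable_real_indicator cylinder_measurable s0)
      (simp_all add: emeasure_eq_measure)
  show "integrable M (\<lambda>\<omega>. \<Phi> (\<lambda>k. Q (s k) \<omega>))"
    using Bochner_Integration.integrable_cong[OF refl eq, THEN iffD2,
      OF _ Bochner_Integration.integrable_sum[OF int]] by blast
  have prob: "expectation (\<lambda>\<omega>. \<Phi> x * indicator (?C x) \<omega>) = \<Phi> x * prob (?C x)" for x
  proof -
    have "?C x \<inter> space M = ?C x" by blast
    then show ?thesis by (simp only: integral_mult_right_zero Bochner_Integration.integral_indicator)
  qed
  have "expectation (\<lambda>\<omega>. \<Phi> (\<lambda>k. Q (s k) \<omega>)) =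
      expectation (\<lambda>\<omega>. \<Sum>x\<in>?X. \<Phi> x * indicator (?C x) \<omega>)"
    by (rule Bochner_Integration.integral_cong[OF refl eq])
  also have "\<dots> = (\<Sum>x\<in>?X. expectation (\<lambda>\<omega>. \<Phi> x * indicator (?C x) \<omega>))"
    by (rule Bochner_Integration.integral_sum[OF int])
  also have "\<dots> = (\<Sum>x\<in>?X. \<Phi> x * prob (?C x))"
    by (simp only: prob)
  finally show "expectation (\<lambda>\<omega>. \<Phi> (\<lambda>k. Q (s k) \<omega>)) = (\<Sum>x\<in>?X. \<Phi> x * prob (?C x))" .
qed

definition step_mean :: "real \<Rightarrow> (nat \<Rightarrow> nat \<Rightarrow> real) \<Rightarrow> nat \<Rightarrow> real" where
  "step_mean h f i = (\<Sum>j\<in>S. p h i j * f i j)"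

definition jump_rate_mean :: "(nat \<Rightarrow> nat \<Rightarrow> real) \<Rightarrow> nat \<Rightarrow> real" where
  "jump_rate_mean f i = (\<Sum>j\<in>S. G i j * f i j)"

lemma PiE_atMost_Suc_bij:
  "bij_betw (\<lambda>(x, j). x(Suc n := j)) (PiE {..n} (\<lambda>_. S) \<times> S) (PiE {..Suc n} (\<lambda>_. S))"
proof (rule bij_betw_byWitness[where f' = "\<lambda>y. (restrict y {..n}, y (Suc n))"], goal_cases)
  case 1
  then show ?case by (auto simp: fun_eq_iff PiE_def extensional_def)
next
  case 2
  then show ?case by (auto simp: fun_eq_iff PiE_def extensional_def)
next
  case 3
  then show ?case by (auto simp: PiE_def extensional_def Pi_def)
next
  case 4
  then show ?case by (auto simp: PiE_def extensional_def Pi_def)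
qed

text \<open>The Markov property in integrated form: given the states at the times up to
  \<open>s n\<close>, one step of length \<open>h\<close> may be averaged with the transition
  probabilities.\<close>

lemma expectation_markov_step:
  fixes \<psi> :: "(nat \<Rightarrow> nat) \<Rightarrow> real"
  assumes s: "0 \<le> s 0" "\<And>k. k \<le> n \<Longrightarrow> s k < s (Suc k)"
    and \<psi>: "\<And>y. \<psi> (restrict y {..n}) = \<psi> y"
  shows "expectation (\<lambda>\<omega>. \<psi> (\<lambda>k. Q (s k) \<omega>) * f (Q (s n) \<omega>) (Q (s (Suc n)) \<omega>)) =
    expectation (\<lambda>\<omega>. \<psi> (\<lambda>k. Q (s k) \<omega>) * step_mean (s (Suc n) - s n) f (Q (s n) \<omega>))"
proof -
  let ?X = "PiE {..n} (\<lambda>_. S)"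
  let ?C = "\<lambda>x. {\<omega> \<in> space M. \<forall>k\<le>n. Q (s k) \<omega> = x k}"
  let ?h = "s (Suc n) - s n"
  have s0: "0 \<le> s k" if "k \<le> Suc n" for k
    using that
  proof (induction k)
    case (Suc k)
    then show ?case using s(2)[of k] by simp
  qed (use s in simp)
  have \<psi>': "\<psi> y = \<psi> y'" if "\<And>k. k \<le> n \<Longrightarrow> y k = y' k" for y y'
  proof -
    have "restrict y {..n} = restrict y' {..n}" using that by (auto simp: restrict_def)
    with \<psi>[of y] \<psi>[of y'] show ?thesis by simp
  qed
  have "expectation (\<lambda>\<omega>. \<psi> (\<lambda>k. Q (s k) \<omega>) * f (Q (s n) \<omega>) (Q (s (Suc n)) \<omega>)) =
      (\<Sum>y\<in>PiE {..Suc n} (\<lambda>_. S). \<psi> y * f (y n) (y (Suc n)) *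
        prob {\<omega> \<in> space M. \<forall>k\<le>Suc n. Q (s k) \<omega> = y k})"
    using s0 by (intro expectation_cylinder[where \<Phi> = "\<lambda>y. \<psi> y * f (y n) (y (Suc n))"])
      (auto intro!: arg_cong2[where f = "(*)"] \<psi>')
  also have "\<dots> = (\<Sum>(x, j)\<in>?X \<times> S. \<psi> (x(Suc n := j)) * f (x n) j *
        prob {\<omega> \<in> space M. \<forall>k\<le>Suc n. Q (s k) \<omega> = (x(Suc n := j)) k})"
    by (subst sum.reindex_bij_betw[OF PiE_atMost_Suc_bij, symmetric])
      (auto intro!: sum.cong simp: split_beta)
  also have "\<dots> = (\<Sum>(x, j)\<in>?X \<times> S. \<psi> x * f (x n) j * (prob (?C x) * p ?h (x n) j))"
  proof (intro sum.cong refl, clarify)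
    fix x j assume x: "x \<in> ?X" and j: "j \<in> S"
    have "{\<omega> \<in> space M. \<forall>k\<le>Suc n. Q (s k) \<omega> = (x(Suc n := j)) k} =
        {\<omega> \<in> space M. Q (s n + ?h) \<omega> = j \<and> (\<forall>k\<le>n. Q (s k) \<omega> = x k)}"
    proof (intro Collect_cong conj_cong refl)
      fix \<omega>
      show "(\<forall>k\<le>Suc n. Q (s k) \<omega> = (x(Suc n := j)) k) \<longleftrightarrow>
          Q (s n + ?h) \<omega> = j \<and> (\<forall>k\<le>n. Q (s k) \<omega> = x k)"
        unfolding le_Suc_eq by (simp add: all_conj_distrib disj_imp) (auto simp del: atMost_iff)
    qed
    moreover have "prob \<dots> = prob (?C x) * p ?h (x n) j"
      using s s0 j by (intro prob_cylinder_step) (auto intro: less_imp_le)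
    moreover have "\<psi> (x(Suc n := j)) = \<psi> x" by (rule \<psi>') simp
    ultimately show "\<psi> (x(Suc n := j)) * f (x n) j *
        prob {\<omega> \<in> space M. \<forall>k\<le>Suc n. Q (s k) \<omega> = (x(Suc n := j)) k} =
        \<psi> x * f (x n) j * (prob (?C x) * p ?h (x n) j)" by simp
  qed
  also have "\<dots> = (\<Sum>x\<in>?X. \<psi> x * step_mean ?h f (x n) * prob (?C x))"
    by (simp only: sum.cartesian_product[symmetric] step_mean_def sum_distrib_left sum_distrib_right mult_ac)
  also have "\<dots> = expectation (\<lambda>\<omega>. \<psi> (\<lambda>k. Q (s k) \<omega>) * step_mean ?h f (Q (s n) \<omega>))"
    using s0 by (intro expectation_cylinder[where \<Phi> = "\<lambda>y. \<psi> y * step_mean ?h f (y n)", symmetric])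
      (auto intro!: arg_cong2[where f = "(*)"] \<psi>')
  finally show ?thesis .
qed

definition grid :: "real \<Rightarrow> nat \<Rightarrow> 'a \<Rightarrow> nat \<Rightarrow> nat" where
  "grid t n \<omega> k = Q (t / n * k) \<omega>"

definition compensated_sum :: "real \<Rightarrow> (nat \<Rightarrow> nat \<Rightarrow> real) \<Rightarrow> nat \<Rightarrow> (nat \<Rightarrow> nat) \<Rightarrow> real" where
  "compensated_sum h f l y = (\<Sum>m<l. f (y m) (y (Suc m)) - step_mean h f (y m))"

lemma integrable_grid:
  fixes \<Phi> :: "(nat \<Rightarrow> nat) \<Rightarrow> real"
  assumes "0 < t" "0 < n" "\<And>y. \<Phi> (restrict y {..l}) = \<Phi> y"
  shows "integrable M (\<lambda>\<omega>. \<Phi> (grid t n \<omega>))"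
  unfolding grid_def
proof (rule integrable_cylinder[where n = l and s = "\<lambda>k. t / n * real k"])
  show "\<Phi> (restrict y {..l}) = \<Phi> y" for y by (rule assms(3))
qed (use assms(1) in simp)

lemma expectation_grid_step:
  fixes \<psi> :: "(nat \<Rightarrow> nat) \<Rightarrow> real"
  assumes t: "0 < t" and n: "0 < n" and \<psi>: "\<And>y. \<psi> (restrict y {..l}) = \<psi> y"
  shows "expectation (\<lambda>\<omega>. \<psi> (grid t n \<omega>) * f (grid t n \<omega> l) (grid t n \<omega> (Suc l))) =
    expectation (\<lambda>\<omega>. \<psi> (grid t n \<omega>) * step_mean (t / n) f (grid t n \<omega> l))"
proof -
  have d: "t / n * Suc l - t / n * l = t / n" by (simp add: algebra_simps diff_divide_distrib[symmetric])
  show ?thesis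
    unfolding grid_def
    using expectation_markov_step[where s = "\<lambda>k. t / n * real k" and n = l and f = f and \<psi> = \<psi>, unfolded d] t n \<psi>
    by (simp add: divide_strict_right_mono)
qed

text \<open>The compensated increments are martingale differences, hence orthogonal: the cross terms of
  the square of the sum vanish.\<close>

lemma expectation_compensated_sum_square:
  assumes t: "0 < t" and n: "0 < n"
  shows "expectation (\<lambda>\<omega>. (compensated_sum (t / n) f l (grid t n \<omega>))\<^sup>2) =
    (\<Sum>m<l. expectation (\<lambda>\<omega>. (f (grid t n \<omega> m) (grid t n \<omega> (Suc m)))\<^sup>2) -
      expectation (\<lambda>\<omega>. (step_mean (t / n) f (grid t n \<omega> m))\<^sup>2))"
proof (induction l)
  case 0
  then show ?case by (simp add: compensated_sum_def)
next
  case (Suc l)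
  let ?g = "grid t n" and ?e = "step_mean (t / n) f"
  let ?T = "\<lambda>\<omega>. compensated_sum (t / n) f l (?g \<omega>)"
  let ?F = "\<lambda>\<omega>. f (?g \<omega> l) (?g \<omega> (Suc l))" and ?D = "\<lambda>\<omega>. ?e (?g \<omega> l)"
  have T: "compensated_sum (t / n) f l (restrict y {..l}) = compensated_sum (t / n) f l y" for y
    by (auto simp: compensated_sum_def intro!: sum.cong)
  have T': "compensated_sum (t / n) f l (restrict y {..Suc l}) = compensated_sum (t / n) f l y" for y
    by (auto simp: compensated_sum_def intro!: sum.cong)
  note int = integrable_grid[OF t n, where l = "Suc l"]
  have i1: "integrable M (\<lambda>\<omega>. (?T \<omega>)\<^sup>2)"
    by (rule int[where \<Phi> = "\<lambda>y. (compensated_sum (t / n) f l y)\<^sup>2"]) (simp add: T')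
  have i2: "integrable M (\<lambda>\<omega>. ?T \<omega> * ?F \<omega>)"
    by (rule int[where \<Phi> = "\<lambda>y. compensated_sum (t / n) f l y * f (y l) (y (Suc l))"]) (simp add: T')
  have i3: "integrable M (\<lambda>\<omega>. ?T \<omega> * ?D \<omega>)"
    by (rule int[where \<Phi> = "\<lambda>y. compensated_sum (t / n) f l y * ?e (y l)"]) (simp add: T')
  have i4: "integrable M (\<lambda>\<omega>. (?F \<omega>)\<^sup>2)"
    by (rule int[where \<Phi> = "\<lambda>y. (f (y l) (y (Suc l)))\<^sup>2"]) simp
  have i5: "integrable M (\<lambda>\<omega>. ?D \<omega> * ?F \<omega>)"
    by (rule int[where \<Phi> = "\<lambda>y. ?e (y l) * f (y l) (y (Suc l))"]) simp
  have i6: "integrable M (\<lambda>\<omega>. (?D \<omega>)\<^sup>2)"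
    by (rule int[where \<Phi> = "\<lambda>y. (?e (y l))\<^sup>2"]) simp
  have e1: "expectation (\<lambda>\<omega>. ?T \<omega> * ?F \<omega>) = expectation (\<lambda>\<omega>. ?T \<omega> * ?D \<omega>)"
    by (rule expectation_grid_step[where \<psi> = "compensated_sum (t / n) f l", OF t n T])
  have e2: "expectation (\<lambda>\<omega>. ?D \<omega> * ?F \<omega>) = expectation (\<lambda>\<omega>. (?D \<omega>)\<^sup>2)"
    using expectation_grid_step[OF t n, where \<psi> = "\<lambda>y. ?e (y l)" and l = l and f = f]
    by (simp add: power2_eq_square)
  have "expectation (\<lambda>\<omega>. (compensated_sum (t / n) f (Suc l) (?g \<omega>))\<^sup>2) =
      expectation (\<lambda>\<omega>. (?T \<omega>)\<^sup>2 + 2 * (?T \<omega> * ?F \<omega>) - 2 * (?T \<omega> * ?D \<omega>) + (?F \<omega>)\<^sup>2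
        - 2 * (?D \<omega> * ?F \<omega>) + (?D \<omega>)\<^sup>2)"
    by (intro Bochner_Integration.integral_cong) (auto simp: compensated_sum_def power2_eq_square algebra_simps)
  also have "\<dots> = expectation (\<lambda>\<omega>. (?T \<omega>)\<^sup>2) + expectation (\<lambda>\<omega>. (?F \<omega>)\<^sup>2)
      - expectation (\<lambda>\<omega>. (?D \<omega>)\<^sup>2)"
    using i1 i2 i3 i4 i5 i6 e1 e2 by simp
  finally show ?case using Suc.IH by simp
qed

lemma grid_in_S: "\<omega> \<in> space M \<Longrightarrow> 0 < t \<Longrightarrow> grid t n \<omega> k \<in> S"
  unfolding grid_def by (intro Q_in_S) auto

lemma grid_sum_eq: "grid_sum f (\<lambda>s. Q s \<omega>) t n = (\<Sum>m<n. f (grid t n \<omega> m) (grid t n \<omega> (Suc m)))"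
  by (simp add: grid_sum_def grid_def)

text \<open>Since \<open>f\<close> vanishes on the diagonal, \<open>p 0\<close> may be subtracted from the transition
  probabilities in the mean over one step, which is thereby a combination of difference quotients
  at 0.\<close>

lemma step_mean_scaled_tendsto:
  assumes t: "0 < t" and i: "i \<in> S" and f0: "\<And>i. f i i = 0"
  shows "(\<lambda>n. real n * step_mean (t / n) f i) \<longlonglongrightarrow> t * jump_rate_mean f i"
proof -
  have lim: "filterlim (\<lambda>n. t / real n) (at 0 within {0..}) sequentially"
    unfolding filterlim_at
  proof (intro conjI lim_const_over_n)
    show "\<forall>\<^sub>F n in sequentially. t / real n \<in> {0..} \<and> t / real n \<noteq> 0"
      using eventually_gt_at_top[of 0] by eventually_elim (use t in auto)
  qed
  have "(\<lambda>n. t * (\<Sum>j\<in>S. (p (t / n) i j - p 0 i j) / (t / n) * f i j)) \<longlonglongrightarrow> t * (\<Sum>j\<in>S. G i j * f i j)"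
  proof (intro tendsto_intros)
    fix j assume "j \<in> S"
    then have "((\<lambda>h. (p h i j - p 0 i j) / (h - 0)) \<longlongrightarrow> G i j) (at 0 within {0..})"
      using generator[OF i] by (simp add: has_field_derivative_iff)
    from filterlim_compose[OF this lim]
    show "(\<lambda>n. (p (t / n) i j - p 0 i j) / (t / n)) \<longlonglongrightarrow> G i j" by simp
  qed
  then have lim': "(\<lambda>n. t * (\<Sum>j\<in>S. (p (t / n) i j - p 0 i j) / (t / n) * f i j)) \<longlonglongrightarrow> t * jump_rate_mean f i"
    by (simp add: jump_rate_mean_def)
  have ev: "\<forall>\<^sub>F n in sequentially. t * (\<Sum>j\<in>S. (p (t / n) i j - p 0 i j) / (t / n) * f i j) =
      real n * step_mean (t / n) f i"
    using eventually_gt_at_top[of 0]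
  proof eventually_elim
    case (elim n)
    have "(p (t / n) i j - p 0 i j) * f i j = p (t / n) i j * f i j" if "j \<in> S" for j
      using p_zero[OF i that] f0 by auto
    then have "t * ((p (t / n) i j - p 0 i j) / (t / n) * f i j) = n * (p (t / n) i j * f i j)"
      if "j \<in> S" for j using that t elim by (simp add: field_simps)
    then show ?case by (simp add: step_mean_def sum_distrib_left)
  qed
  show ?thesis using Lim_transform_eventually[OF lim' ev] .
qed

text \<open>With finitely many states the convergence of the one-step means is uniform in the state, so
  the compensator converges uniformly over all paths.\<close>

lemma compensator_tendsto:
  assumes t: "0 < t" and f0: "\<And>i. f i i = 0" and c: "\<And>i. i \<in> S \<Longrightarrow> jump_rate_mean f i = c"
  obtains \<epsilon> where "\<epsilon> \<longlonglongrightarrow> 0"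
    and "\<And>n \<omega>. 0 < n \<Longrightarrow> \<omega> \<in> space M \<Longrightarrow>
      \<bar>(\<Sum>m<n. step_mean (t / n) f (grid t n \<omega> m)) - c * t\<bar> \<le> \<epsilon> n"
proof
  let ?\<epsilon> = "\<lambda>n. \<Sum>i\<in>S. \<bar>real n * step_mean (t / n) f i - t * jump_rate_mean f i\<bar>"
  have "?\<epsilon> \<longlonglongrightarrow> (\<Sum>i\<in>S. \<bar>t * jump_rate_mean f i - t * jump_rate_mean f i\<bar>)"
    by (intro tendsto_intros step_mean_scaled_tendsto t f0)
  then show "?\<epsilon> \<longlonglongrightarrow> 0" by simp
  fix n :: nat and \<omega> assume n: "0 < n" and \<omega>: "\<omega> \<in> space M"
  have "(\<Sum>m<n. step_mean (t / n) f (grid t n \<omega> m)) - c * t =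
      (\<Sum>m<n. step_mean (t / n) f (grid t n \<omega> m) - c * t / n)"
    using n by (simp add: sum_subtractf)
  then have "\<bar>(\<Sum>m<n. step_mean (t / n) f (grid t n \<omega> m)) - c * t\<bar> \<le>
      (\<Sum>m<n. \<bar>step_mean (t / n) f (grid t n \<omega> m) - c * t / n\<bar>)"
    by (simp add: sum_abs)
  also have "\<dots> \<le> (\<Sum>m<n. ?\<epsilon> n / n)"
  proof (rule sum_mono)
    fix m
    let ?i = "grid t n \<omega> m"
    have i: "?i \<in> S" using grid_in_S[OF \<omega> t] .
    have "real n * \<bar>step_mean (t / n) f ?i - c * t / n\<bar> = \<bar>real n * (step_mean (t / n) f ?i - c * t / n)\<bar>"
      by (simp add: abs_mult)
    also have "\<dots> = \<bar>real n * step_mean (t / n) f ?i - t * jump_rate_mean f ?i\<bar>"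
      using n c[OF i] by (simp add: right_diff_distrib mult.commute)
    also have "\<dots> \<le> ?\<epsilon> n"
      using i finite_S by (intro member_le_sum[where f = "\<lambda>i. \<bar>real n * step_mean (t / n) f i - t * jump_rate_mean f i\<bar>"]) auto
    finally show "\<bar>step_mean (t / n) f ?i - c * t / n\<bar> \<le> ?\<epsilon> n / n"
      using n by (simp add: field_simps)
  qed
  also have "\<dots> = ?\<epsilon> n" using n by simp
  finally show "\<bar>(\<Sum>m<n. step_mean (t / n) f (grid t n \<omega> m)) - c * t\<bar> \<le> ?\<epsilon> n" .
qed

lemma step_mean_bound:
  assumes t: "0 < t" and f0: "\<And>i. f i i = 0"
  obtains B where "0 \<le> B" "\<And>n i. 0 < n \<Longrightarrow> i \<in> S \<Longrightarrow> \<bar>step_mean (t / real n) f i\<bar> \<le> B / real n"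
proof -
  have "(\<lambda>n. \<Sum>i\<in>S. \<bar>real n * step_mean (t / n) f i\<bar>) \<longlonglongrightarrow> (\<Sum>i\<in>S. \<bar>t * jump_rate_mean f i\<bar>)"
    by (intro tendsto_intros step_mean_scaled_tendsto t f0)
  then have "Bseq (\<lambda>n. \<Sum>i\<in>S. \<bar>real n * step_mean (t / n) f i\<bar>)"
    by (intro convergent_imp_Bseq convergentI)
  then obtain B where B: "0 < B" "\<And>n. \<bar>\<Sum>i\<in>S. \<bar>real n * step_mean (t / n) f i\<bar>\<bar> \<le> B"
    by (auto simp: Bseq_def)
  show thesis
  proof
    show "0 \<le> B" using B by simp
    fix n :: nat and i assume n: "0 < n" and i: "i \<in> S"
    have "\<bar>real n * step_mean (t / n) f i\<bar> \<le> (\<Sum>i\<in>S. \<bar>real n * step_mean (t / n) f i\<bar>)"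
      using i finite_S by (intro member_le_sum[where f = "\<lambda>i. \<bar>real n * step_mean (t / n) f i\<bar>"]) auto
    also have "\<dots> \<le> B" using B(2)[of n] by linarith
    finally show "\<bar>step_mean (t / n) f i\<bar> \<le> B / n"
      using n by (simp add: abs_mult field_simps)
  qed
qed

abbreviation path :: "'a \<Rightarrow> real \<Rightarrow> nat" where "path \<omega> \<equiv> (\<lambda>s. Q s \<omega>)"

lemma jump_sum_measurable:
  "0 < t \<Longrightarrow> (\<And>i. f i i = 0) \<Longrightarrow> (\<lambda>\<omega>. jump_sum f (path \<omega>) t) \<in> borel_measurable M"
  by (rule borel_measurable_jump_sum) (auto intro: Q_measurable step_path_Q)

lemma jump_count_measurable:
  assumes "0 < t"
  shows "(\<lambda>\<omega>. jump_sum (\<lambda>i j. 1) (path \<omega>) t) \<in> borel_measurable M"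
proof -
  have "jump_sum (\<lambda>i j. 1) (path \<omega>) t = jump_sum (\<lambda>i j. of_bool (i \<noteq> j)) (path \<omega>) t" for \<omega>
    by (rule jump_sum_offdiagonal) simp
  then show ?thesis using assms by (simp add: jump_sum_measurable)
qed

lemma bounded_on_states:
  fixes f :: "nat \<Rightarrow> nat \<Rightarrow> real"
  obtains C where "0 \<le> C" "\<And>i j. i \<in> S \<Longrightarrow> j \<in> S \<Longrightarrow> \<bar>f i j\<bar> \<le> C"
proof
  let ?C = "\<Sum>(i, j)\<in>S \<times> S. \<bar>f i j\<bar>"
  show "0 \<le> ?C" by (intro sum_nonneg) auto
  fix i j assume "i \<in> S" "j \<in> S"
  then show "\<bar>f i j\<bar> \<le> ?C"
    using finite_S member_le_sum[of "(i, j)" "S \<times> S" "\<lambda>(i, j). \<bar>f i j\<bar>"] by auto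
qed

definition compensator :: "(nat \<Rightarrow> nat \<Rightarrow> real) \<Rightarrow> real \<Rightarrow> nat \<Rightarrow> 'a \<Rightarrow> real" where
  "compensator f t n \<omega> = (\<Sum>m<n. step_mean (t / n) f (grid t n \<omega> m))"

lemma integrable_grid_sum:
  assumes "0 < t" "0 < n"
  shows "integrable M (\<lambda>\<omega>. grid_sum f (path \<omega>) t n)"
  unfolding grid_sum_eq
  by (rule integrable_grid[where \<Phi> = "\<lambda>y. \<Sum>m<n. f (y m) (y (Suc m))" and l = n, OF assms])
    (auto intro!: sum.cong)

lemma integrable_grid_sum_square:
  assumes "0 < t" "0 < n"
  shows "integrable M (\<lambda>\<omega>. (grid_sum f (path \<omega>) t n)\<^sup>2)"
  unfolding grid_sum_eq
  by (rule integrable_grid[where \<Phi> = "\<lambda>y. (\<Sum>m<n. f (y m) (y (Suc m)))\<^sup>2" and l = n, OF assms])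
    (auto intro!: sum.cong arg_cong[where f = "\<lambda>u. u\<^sup>2"])

lemma integrable_compensator:
  assumes "0 < t" "0 < n"
  shows "integrable M (compensator f t n)"
proof -
  have "integrable M (\<lambda>\<omega>. compensator f t n \<omega>)"
    unfolding compensator_def
    by (rule integrable_grid[where \<Phi> = "\<lambda>y. \<Sum>m<n. step_mean (t / n) f (y m)" and l = n, OF assms])
      (auto intro!: sum.cong)
  then show ?thesis by simp
qed

lemma integrable_compensated_square:
  assumes "0 < t" "0 < n"
  shows "integrable M (\<lambda>\<omega>. (grid_sum f (path \<omega>) t n - compensator f t n \<omega>)\<^sup>2)"
  unfolding grid_sum_eq compensator_def
  by (rule integrable_grid[where l = n and \<Phi> = "\<lambda>y. ((\<Sum>m<n. f (y m) (y (Suc m))) -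
      (\<Sum>m<n. step_mean (t / n) f (y m)))\<^sup>2", OF assms])
    (auto intro!: sum.cong arg_cong2[where f = "(-)"] arg_cong[where f = "\<lambda>u. u\<^sup>2"])

lemma expectation_grid_sum:
  assumes t: "0 < t" and n: "0 < n"
  shows "expectation (\<lambda>\<omega>. grid_sum f (path \<omega>) t n) = expectation (compensator f t n)"
proof -
  have i1: "integrable M (\<lambda>\<omega>. f (grid t n \<omega> m) (grid t n \<omega> (Suc m)))" for m
    by (rule integrable_grid[OF t n, where l = "Suc m" and \<Phi> = "\<lambda>y. f (y m) (y (Suc m))"]) simp
  have i2: "integrable M (\<lambda>\<omega>. step_mean (t / n) f (grid t n \<omega> m))" for m
    by (rule integrable_grid[OF t n, where l = "m" and \<Phi> = "\<lambda>y. step_mean (t / n) f (y m)"]) simp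
  have "expectation (\<lambda>\<omega>. grid_sum f (path \<omega>) t n) =
      (\<Sum>m<n. expectation (\<lambda>\<omega>. f (grid t n \<omega> m) (grid t n \<omega> (Suc m))))"
    unfolding grid_sum_eq by (rule Bochner_Integration.integral_sum[OF i1])
  also have "\<dots> = (\<Sum>m<n. expectation (\<lambda>\<omega>. step_mean (t / n) f (grid t n \<omega> m)))"
    using expectation_grid_step[OF t n, where \<psi> = "\<lambda>_. 1" and f = f] by simp
  also have "\<dots> = expectation (\<lambda>\<omega>. \<Sum>m<n. step_mean (t / n) f (grid t n \<omega> m))"
    by (rule Bochner_Integration.integral_sum[OF i2, symmetric])
  finally show ?thesis by (simp add: compensator_def[abs_def])
qed

lemma expectation_compensated_square:
  assumes t: "0 < t" and n: "0 < n"
  shows "expectation (\<lambda>\<omega>. (grid_sum f (path \<omega>) t n - compensator f t n \<omega>)\<^sup>2) =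
    expectation (\<lambda>\<omega>. grid_sum (\<lambda>i j. (f i j)\<^sup>2) (path \<omega>) t n) -
    (\<Sum>m<n. expectation (\<lambda>\<omega>. (step_mean (t / n) f (grid t n \<omega> m))\<^sup>2))"
proof -
  have i1: "integrable M (\<lambda>\<omega>. (f (grid t n \<omega> m) (grid t n \<omega> (Suc m)))\<^sup>2)" for m
    by (rule integrable_grid[OF t n, where l = "Suc m" and \<Phi> = "\<lambda>y. (f (y m) (y (Suc m)))\<^sup>2"]) simp
  have "expectation (\<lambda>\<omega>. grid_sum (\<lambda>i j. (f i j)\<^sup>2) (path \<omega>) t n) =
      (\<Sum>m<n. expectation (\<lambda>\<omega>. (f (grid t n \<omega> m) (grid t n \<omega> (Suc m)))\<^sup>2))"
    unfolding grid_sum_eq by (rule Bochner_Integration.integral_sum[OF i1])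
  moreover have "grid_sum f (path \<omega>) t n - compensator f t n \<omega> =
      compensated_sum (t / n) f n (grid t n \<omega>)" for \<omega>
    by (simp add: grid_sum_eq compensator_def compensated_sum_def sum_subtractf)
  ultimately show ?thesis
    using expectation_compensated_sum_square[OF t n, of f n] by (simp add: sum_subtractf)
qed

lemma abs_compensator_le:
  assumes "0 < t" "0 < n" "\<omega> \<in> space M"
    and B: "\<And>i. i \<in> S \<Longrightarrow> \<bar>step_mean (t / real n) f i\<bar> \<le> B / real n"
  shows "\<bar>compensator f t n \<omega>\<bar> \<le> B"
proof -
  have "\<bar>compensator f t n \<omega>\<bar> \<le> (\<Sum>m<n. \<bar>step_mean (t / n) f (grid t n \<omega> m)\<bar>)"
    unfolding compensator_def by (rule sum_abs)
  also have "\<dots> \<le> (\<Sum>m<n. B / n)" using assms by (intro sum_mono B grid_in_S)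
  also have "\<dots> = B" using assms by simp
  finally show ?thesis .
qed

text \<open>For the indicator of a change of state the square and the function agree, so the
  martingale identity bounds the second moment of the number of observed changes by its mean,
  uniformly in the mesh. Fatou's lemma passes the bound on to the number of jumps.\<close>

lemma integrable_jump_count_square:
  assumes t: "0 < t"
  shows "integrable M (\<lambda>\<omega>. (jump_sum (\<lambda>i j. 1) (path \<omega>) t)\<^sup>2)"
proof -
  define \<kappa> where "\<kappa> = (\<lambda>i j :: nat. of_bool (i \<noteq> j) :: real)"
  have \<kappa>0: "\<kappa> i i = 0" for i by (simp add: \<kappa>_def)
  have \<kappa>2: "(\<lambda>i j. (\<kappa> i j)\<^sup>2) = \<kappa>" by (simp add: \<kappa>_def fun_eq_iff)
  have N: "jump_sum (\<lambda>i j. 1) x t = jump_sum \<kappa> x t" for x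
    by (rule jump_sum_offdiagonal) (simp add: \<kappa>_def)
  obtain B where B: "0 \<le> B" "\<And>n i. 0 < n \<Longrightarrow> i \<in> S \<Longrightarrow> \<bar>step_mean (t / real n) \<kappa> i\<bar> \<le> B / real n"
    using step_mean_bound[where f = \<kappa>, OF t \<kappa>0] by blast
  define K where "K = 2 * B + 2 * B\<^sup>2"
  let ?g = "\<lambda>n \<omega>. grid_sum \<kappa> (path \<omega>) t (Suc n)"
  let ?c = "\<lambda>n \<omega>. compensator \<kappa> t (Suc n) \<omega>"
  have bound: "expectation (\<lambda>\<omega>. (?g n \<omega>)\<^sup>2) \<le> K" for n
  proof -
    note tn = t zero_less_Suc[of n]
    have c: "\<bar>?c n \<omega>\<bar> \<le> B" if "\<omega> \<in> space M" for \<omega>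
      by (rule abs_compensator_le[OF tn that]) (rule B(2), auto)
    have Ec: "expectation (?c n) \<le> B"
    proof -
      have "expectation (?c n) \<le> expectation (\<lambda>_. B)"
        using c by (intro integral_mono integrable_compensator tn) (auto simp: abs_le_iff)
      then show ?thesis by (simp add: prob_space)
    qed
    have "expectation (\<lambda>\<omega>. (?g n \<omega> - ?c n \<omega>)\<^sup>2) \<le> expectation (?g n)"
      unfolding expectation_compensated_square[OF tn] \<kappa>2
      by (intro diff_le_eq[THEN iffD2] le_add_same_cancel1[THEN iffD2] sum_nonneg Bochner_Integration.integral_nonneg zero_le_power2)
    then have m: "expectation (\<lambda>\<omega>. (?g n \<omega> - ?c n \<omega>)\<^sup>2) \<le> B"
      using Ec unfolding expectation_grid_sum[OF tn] by simp
    have "expectation (\<lambda>\<omega>. (?g n \<omega>)\<^sup>2) \<le> expectation (\<lambda>\<omega>. 2 * (?g n \<omega> - ?c n \<omega>)\<^sup>2 + 2 * B\<^sup>2)"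
    proof (intro integral_mono)
      show "integrable M (\<lambda>\<omega>. (?g n \<omega>)\<^sup>2)" by (rule integrable_grid_sum_square[OF tn])
      show "integrable M (\<lambda>\<omega>. 2 * (?g n \<omega> - ?c n \<omega>)\<^sup>2 + 2 * B\<^sup>2)"
        by (intro Bochner_Integration.integrable_add integrable_mult_right integrable_compensated_square[OF tn])
          simp
      fix \<omega> assume "\<omega> \<in> space M"
      then have c2: "(?c n \<omega>)\<^sup>2 \<le> B\<^sup>2" using c by (intro power2_le_iff_abs_le[THEN iffD2]) (use B in auto)
      have "(a::real)\<^sup>2 \<le> 2 * (a - b)\<^sup>2 + 2 * b\<^sup>2" for a b
        using zero_le_power2[of "a - 2 * b"] by (simp add: power2_eq_square algebra_simps)
      from this[of "?g n \<omega>" "?c n \<omega>"] c2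
      show "(?g n \<omega>)\<^sup>2 \<le> 2 * (?g n \<omega> - ?c n \<omega>)\<^sup>2 + 2 * B\<^sup>2" by linarith
    qed
    also have "\<dots> = 2 * expectation (\<lambda>\<omega>. (?g n \<omega> - ?c n \<omega>)\<^sup>2) + 2 * B\<^sup>2"
      using integrable_compensated_square[OF tn, of \<kappa>] by (simp add: prob_space)
    also have "\<dots> \<le> K" using m by (simp add: K_def)
    finally show ?thesis .
  qed
  have "(\<integral>\<^sup>+\<omega>. ennreal ((jump_sum \<kappa> (path \<omega>) t)\<^sup>2) \<partial>M) =
      (\<integral>\<^sup>+\<omega>. liminf (\<lambda>n. ennreal ((?g n \<omega>)\<^sup>2)) \<partial>M)"
  proof (rule nn_integral_cong)
    fix \<omega> assume "\<omega> \<in> space M"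
    have "(\<lambda>n. ?g n \<omega>) \<longlonglongrightarrow> jump_sum \<kappa> (path \<omega>) t"
      using \<open>\<omega> \<in> space M\<close> by (intro LIMSEQ_Suc grid_sum_tendsto_jump_sum step_path_Q t \<kappa>0)
    then have "(\<lambda>n. ennreal ((?g n \<omega>)\<^sup>2)) \<longlonglongrightarrow> ennreal ((jump_sum \<kappa> (path \<omega>) t)\<^sup>2)"
      by (intro tendsto_intros)
    then show "ennreal ((jump_sum \<kappa> (path \<omega>) t)\<^sup>2) = liminf (\<lambda>n. ennreal ((?g n \<omega>)\<^sup>2))"
      by (intro lim_imp_Liminf[symmetric]) simp_all
  qed
  also have "\<dots> \<le> liminf (\<lambda>n. \<integral>\<^sup>+\<omega>. ennreal ((?g n \<omega>)\<^sup>2) \<partial>M)"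
  proof (rule nn_integral_liminf)
    fix n
    have "?g n \<in> borel_measurable M"
      using integrable_grid_sum[OF t zero_less_Suc] by (rule borel_measurable_integrable)
    then show "(\<lambda>\<omega>. ennreal ((?g n \<omega>)\<^sup>2)) \<in> borel_measurable M" by measurable
  qed
  also have "\<dots> \<le> limsup (\<lambda>n. \<integral>\<^sup>+\<omega>. ennreal ((?g n \<omega>)\<^sup>2) \<partial>M)"
    by (rule Liminf_le_Limsup) simp
  also have "\<dots> \<le> ennreal K"
  proof (rule Limsup_bounded, rule always_eventually, rule allI)
    fix n
    have "(\<integral>\<^sup>+\<omega>. ennreal ((?g n \<omega>)\<^sup>2) \<partial>M) = ennreal (expectation (\<lambda>\<omega>. (?g n \<omega>)\<^sup>2))"
      by (rule nn_integral_eq_integral[OF integrable_grid_sum_square[OF t zero_less_Suc]]) simp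
    also have "\<dots> \<le> ennreal K" using bound by (rule ennreal_leI)
    finally show "(\<integral>\<^sup>+\<omega>. ennreal ((?g n \<omega>)\<^sup>2) \<partial>M) \<le> ennreal K" .
  qed
  finally have fin: "(\<integral>\<^sup>+\<omega>. ennreal ((jump_sum \<kappa> (path \<omega>) t)\<^sup>2) \<partial>M) < \<infinity>"
    by (rule le_less_trans) simp
  show ?thesis
    unfolding N
  proof (rule integrableI_bounded)
    show "(\<lambda>\<omega>. (jump_sum \<kappa> (path \<omega>) t)\<^sup>2) \<in> borel_measurable M"
      by (intro borel_measurable_power jump_sum_measurable t \<kappa>0)
    show "(\<integral>\<^sup>+\<omega>. ennreal (norm ((jump_sum \<kappa> (path \<omega>) t)\<^sup>2)) \<partial>M) < \<infinity>" using fin by simp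
  qed
qed

lemma jump_count_nonneg: "0 \<le> jump_sum (\<lambda>i j. 1) x t"
  by (simp add: jump_sum_def sum_nonneg)

lemma integrable_jump_count:
  assumes t: "0 < t"
  shows "integrable M (\<lambda>\<omega>. jump_sum (\<lambda>i j. 1) (path \<omega>) t)"
proof (rule Bochner_Integration.integrable_bound)
  show "integrable M (\<lambda>\<omega>. 1 + (jump_sum (\<lambda>i j. 1) (path \<omega>) t)\<^sup>2)"
    using integrable_jump_count_square[OF t] by simp
  have "u \<le> 1 + u\<^sup>2" for u :: real
    using sum_power2_ge_zero[of "u - 1" u] by (simp add: power2_eq_square algebra_simps)
  then show "AE \<omega> in M. norm (jump_sum (\<lambda>i j. 1) (path \<omega>) t) \<le> norm (1 + (jump_sum (\<lambda>i j. 1) (path \<omega>) t)\<^sup>2)"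
    by (simp add: jump_count_nonneg)
qed (rule jump_count_measurable[OF t])

lemma jump_sum_dominated:
  assumes t: "0 < t" and f0: "\<And>i. f i i = 0"
  obtains C where "0 \<le> C"
    "\<And>\<omega>. \<omega> \<in> space M \<Longrightarrow> \<bar>jump_sum f (path \<omega>) t\<bar> \<le> C * jump_sum (\<lambda>i j. 1) (path \<omega>) t"
    "\<And>n \<omega>. 0 < n \<Longrightarrow> \<omega> \<in> space M \<Longrightarrow> \<bar>grid_sum f (path \<omega>) t n\<bar> \<le> C * jump_sum (\<lambda>i j. 1) (path \<omega>) t"
proof -
  obtain C where C: "0 \<le> C" "\<And>i j. i \<in> S \<Longrightarrow> j \<in> S \<Longrightarrow> \<bar>f i j\<bar> \<le> C"
    using bounded_on_states[of f] by blast
  show thesis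
  proof
    fix \<omega> assume \<omega>: "\<omega> \<in> space M"
    have fC: "\<bar>f (Q u \<omega>) (Q v \<omega>)\<bar> \<le> C" if "0 \<le> u" "0 \<le> v" for u v
      using that \<omega> by (intro C Q_in_S)
    show "\<bar>jump_sum f (path \<omega>) t\<bar> \<le> C * jump_sum (\<lambda>i j. 1) (path \<omega>) t"
      by (rule abs_jump_sum_le[where f = f, OF step_path_Q[OF \<omega>] t f0 fC])
    show "\<bar>grid_sum f (path \<omega>) t n\<bar> \<le> C * jump_sum (\<lambda>i j. 1) (path \<omega>) t" if "0 < n" for n
      by (rule abs_grid_sum_le[where f = f, OF step_path_Q[OF \<omega>] t that f0 fC])
  qed (rule C)
qed

lemma integrable_jump_sum:
  assumes t: "0 < t" and f0: "\<And>i. f i i = 0"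
  shows "integrable M (\<lambda>\<omega>. jump_sum f (path \<omega>) t)"
proof -
  obtain C where C: "0 \<le> C" 
    "\<And>\<omega>. \<omega> \<in> space M \<Longrightarrow> \<bar>jump_sum f (path \<omega>) t\<bar> \<le> C * jump_sum (\<lambda>i j. 1) (path \<omega>) t"
    using jump_sum_dominated[where f = f, OF t f0] by metis
  show ?thesis
  proof (rule Bochner_Integration.integrable_bound)
    show "integrable M (\<lambda>\<omega>. C * jump_sum (\<lambda>i j. 1) (path \<omega>) t)"
      by (intro integrable_mult_right integrable_jump_count t)
    show "AE \<omega> in M. norm (jump_sum f (path \<omega>) t) \<le> norm (C * jump_sum (\<lambda>i j. 1) (path \<omega>) t)"
      using C by (intro AE_I2) (simp add: abs_mult jump_count_nonneg)
  qed (rule jump_sum_measurable[OF t f0])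
qed

lemma integrable_jump_sum_square:
  assumes t: "0 < t" and f0: "\<And>i. f i i = 0"
  shows "integrable M (\<lambda>\<omega>. (jump_sum f (path \<omega>) t)\<^sup>2)"
proof -
  obtain C where C: "0 \<le> C" 
    "\<And>\<omega>. \<omega> \<in> space M \<Longrightarrow> \<bar>jump_sum f (path \<omega>) t\<bar> \<le> C * jump_sum (\<lambda>i j. 1) (path \<omega>) t"
    using jump_sum_dominated[where f = f, OF t f0] by metis
  show ?thesis
  proof (rule Bochner_Integration.integrable_bound)
    show "integrable M (\<lambda>\<omega>. C\<^sup>2 * (jump_sum (\<lambda>i j. 1) (path \<omega>) t)\<^sup>2)"
      by (intro integrable_mult_right integrable_jump_count_square t)
    show "AE \<omega> in M. norm ((jump_sum f (path \<omega>) t)\<^sup>2) \<le> norm (C\<^sup>2 * (jump_sum (\<lambda>i j. 1) (path \<omega>) t)\<^sup>2)"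
    proof (rule AE_I2)
      fix \<omega> assume "\<omega> \<in> space M"
      from power_mono[OF C(2)[OF this], of 2]
      show "norm ((jump_sum f (path \<omega>) t)\<^sup>2) \<le> norm (C\<^sup>2 * (jump_sum (\<lambda>i j. 1) (path \<omega>) t)\<^sup>2)"
        by (simp add: power_mult_distrib abs_mult)
    qed
  qed (intro borel_measurable_power jump_sum_measurable[OF t f0])
qed

lemma expectation_grid_sum_tendsto:
  assumes t: "0 < t" and f0: "\<And>i. f i i = 0"
  shows "(\<lambda>n. expectation (\<lambda>\<omega>. grid_sum f (path \<omega>) t (Suc n))) \<longlonglongrightarrow>
    expectation (\<lambda>\<omega>. jump_sum f (path \<omega>) t)"
proof -
  obtain C where C: "0 \<le> C" 
    "\<And>n \<omega>. 0 < n \<Longrightarrow> \<omega> \<in> space M \<Longrightarrow> \<bar>grid_sum f (path \<omega>) t n\<bar> \<le> C * jump_sum (\<lambda>i j. 1) (path \<omega>) t"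
    using jump_sum_dominated[where f = f, OF t f0] by metis
  show ?thesis
  proof (rule integral_dominated_convergence)
    show "integrable M (\<lambda>\<omega>. C * jump_sum (\<lambda>i j. 1) (path \<omega>) t)"
      by (intro integrable_mult_right integrable_jump_count t)
    show "AE \<omega> in M. (\<lambda>n. grid_sum f (path \<omega>) t (Suc n)) \<longlonglongrightarrow> jump_sum f (path \<omega>) t"
      by (intro AE_I2 LIMSEQ_Suc grid_sum_tendsto_jump_sum step_path_Q t f0)
    show "AE \<omega> in M. norm (grid_sum f (path \<omega>) t (Suc n)) \<le> C * jump_sum (\<lambda>i j. 1) (path \<omega>) t" for n
      using C by (intro AE_I2) simp
    show "(\<lambda>\<omega>. jump_sum f (path \<omega>) t) \<in> borel_measurable M" by (rule jump_sum_measurable[OF t f0])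
    show "(\<lambda>\<omega>. grid_sum f (path \<omega>) t (Suc n)) \<in> borel_measurable M" for n
      by (rule borel_measurable_integrable[OF integrable_grid_sum[OF t zero_less_Suc]])
  qed
qed

lemma compensator_limit:
  assumes t: "0 < t" and f0: "\<And>i. f i i = 0" and c: "\<And>i. i \<in> S \<Longrightarrow> jump_rate_mean f i = c"
  obtains \<epsilon> where "\<epsilon> \<longlonglongrightarrow> 0"
    "\<And>n \<omega>. \<omega> \<in> space M \<Longrightarrow> \<bar>compensator f t (Suc n) \<omega> - c * t\<bar> \<le> \<epsilon> n"
proof -
  obtain \<epsilon> where \<epsilon>: "\<epsilon> \<longlonglongrightarrow> 0" and le: "\<And>n \<omega>. 0 < n \<Longrightarrow> \<omega> \<in> space M \<Longrightarrow>
      \<bar>(\<Sum>m<n. step_mean (t / n) f (grid t n \<omega> m)) - c * t\<bar> \<le> \<epsilon> n"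
    using compensator_tendsto[of t f c] t f0 c by metis
  show thesis
    by (rule that[of "\<lambda>n. \<epsilon> (Suc n)"]) (use LIMSEQ_Suc[OF \<epsilon>] le[OF zero_less_Suc] in \<open>simp_all only: compensator_def\<close>)
qed

text \<open>The mean of a jump functional is the time integral of its mean rate along the chain. A rate
  that is the same in all states makes this integral deterministic.\<close>

theorem expectation_jump_sum:
  assumes t: "0 < t" and f0: "\<And>i. f i i = 0" and c: "\<And>i. i \<in> S \<Longrightarrow> jump_rate_mean f i = c"
  shows "expectation (\<lambda>\<omega>. jump_sum f (path \<omega>) t) = c * t"
proof -
  obtain \<epsilon> where \<epsilon>: "\<epsilon> \<longlonglongrightarrow> 0"
    "\<And>n \<omega>. \<omega> \<in> space M \<Longrightarrow> \<bar>compensator f t (Suc n) \<omega> - c * t\<bar> \<le> \<epsilon> n"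
    using compensator_limit[of t f c] t f0 c by metis
  have "(\<lambda>n. expectation (compensator f t (Suc n)) - c * t) \<longlonglongrightarrow> 0"
  proof (rule Lim_null_comparison[OF _ \<epsilon>(1)], rule always_eventually, rule allI)
    fix n
    note tn = t zero_less_Suc[of n]
    have "expectation (compensator f t (Suc n)) - c * t = expectation (\<lambda>\<omega>. compensator f t (Suc n) \<omega> - c * t)"
      using integrable_compensator[OF tn, of f] by (simp add: prob_space)
    then have "norm (expectation (compensator f t (Suc n)) - c * t) \<le> expectation (\<lambda>\<omega>. norm (compensator f t (Suc n) \<omega> - c * t))"
      by (simp only: integral_norm_bound)
    also have "\<dots> \<le> expectation (\<lambda>_. \<epsilon> n)"
      using \<epsilon>(2) integrable_compensator[OF tn, of f] by (intro integral_mono) auto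
    also have "\<dots> = \<epsilon> n" by (simp add: prob_space)
    finally show "norm (expectation (compensator f t (Suc n)) - c * t) \<le> \<epsilon> n" .
  qed
  then have "(\<lambda>n. expectation (compensator f t (Suc n))) \<longlonglongrightarrow> c * t"
    by (simp add: LIM_zero_iff)
  then have "(\<lambda>n. expectation (\<lambda>\<omega>. grid_sum f (path \<omega>) t (Suc n))) \<longlonglongrightarrow> c * t"
    by (simp only: expectation_grid_sum[OF t zero_less_Suc])
  then show ?thesis
    using LIMSEQ_unique[OF expectation_grid_sum_tendsto[where f = f, OF t f0]] by blast
qed

text \<open>This is the isometry for the martingale \<open>X - c t\<close>, whose quadratic variation is the sum
  of the squared jumps. On the grid the identity has a further term, the squared one-step means;
  there are \<open>n\<close> of them, each of order \<open>1 / n\<^sup>2\<close>.\<close>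

theorem expectation_jump_sum_centred_square:
  assumes t: "0 < t" and f0: "\<And>i. f i i = 0" and c: "\<And>i. i \<in> S \<Longrightarrow> jump_rate_mean f i = c"
  shows "expectation (\<lambda>\<omega>. (jump_sum f (path \<omega>) t - c * t)\<^sup>2) =
    expectation (\<lambda>\<omega>. jump_sum (\<lambda>i j. (f i j)\<^sup>2) (path \<omega>) t)"
proof -
  let ?N = "\<lambda>\<omega>. jump_sum (\<lambda>i j. 1) (path \<omega>) t"
  let ?g = "\<lambda>n \<omega>. grid_sum f (path \<omega>) t (Suc n)" and ?c = "\<lambda>n \<omega>. compensator f t (Suc n) \<omega>"
  obtain \<epsilon> where \<epsilon>: "\<epsilon> \<longlonglongrightarrow> 0" "\<And>n \<omega>. \<omega> \<in> space M \<Longrightarrow> \<bar>?c n \<omega> - c * t\<bar> \<le> \<epsilon> n"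
    using compensator_limit[of t f c] t f0 c by metis
  obtain B where B: "0 \<le> B" "\<And>n i. 0 < n \<Longrightarrow> i \<in> S \<Longrightarrow> \<bar>step_mean (t / real n) f i\<bar> \<le> B / real n"
    using step_mean_bound[where f = f, OF t f0] by blast
  obtain C where C: "0 \<le> C" "\<And>n \<omega>. 0 < n \<Longrightarrow> \<omega> \<in> space M \<Longrightarrow> \<bar>grid_sum f (path \<omega>) t n\<bar> \<le> C * ?N \<omega>"
    using jump_sum_dominated[where f = f, OF t f0] by metis
  have lim1: "(\<lambda>n. expectation (\<lambda>\<omega>. (?g n \<omega> - ?c n \<omega>)\<^sup>2)) \<longlonglongrightarrow>
      expectation (\<lambda>\<omega>. (jump_sum f (path \<omega>) t - c * t)\<^sup>2)"
  proof (rule integral_dominated_convergence)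
    show "integrable M (\<lambda>\<omega>. 2 * C\<^sup>2 * (?N \<omega>)\<^sup>2 + 2 * B\<^sup>2)"
      by (intro Bochner_Integration.integrable_add integrable_mult_right integrable_jump_count_square t) simp
    show "(\<lambda>\<omega>. (jump_sum f (path \<omega>) t - c * t)\<^sup>2) \<in> borel_measurable M"
      by (intro borel_measurable_power borel_measurable_diff jump_sum_measurable t f0) simp
    show "(\<lambda>\<omega>. (?g n \<omega> - ?c n \<omega>)\<^sup>2) \<in> borel_measurable M" for n
      by (rule borel_measurable_integrable[OF integrable_compensated_square[OF t zero_less_Suc]])
    show "AE \<omega> in M. (\<lambda>n. (?g n \<omega> - ?c n \<omega>)\<^sup>2) \<longlonglongrightarrow> (jump_sum f (path \<omega>) t - c * t)\<^sup>2"
    proof (rule AE_I2)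
      fix \<omega> assume \<omega>: "\<omega> \<in> space M"
      have "(\<lambda>n. ?c n \<omega> - c * t) \<longlonglongrightarrow> 0"
        using \<epsilon>(2)[OF \<omega>] by (intro Lim_null_comparison[OF _ \<epsilon>(1)]) simp
      then have "(\<lambda>n. ?c n \<omega>) \<longlonglongrightarrow> c * t" by (simp add: LIM_zero_iff)
      then show "(\<lambda>n. (?g n \<omega> - ?c n \<omega>)\<^sup>2) \<longlonglongrightarrow> (jump_sum f (path \<omega>) t - c * t)\<^sup>2"
        by (intro tendsto_power tendsto_diff LIMSEQ_Suc[OF grid_sum_tendsto_jump_sum] step_path_Q[OF \<omega>] t f0)
    qed
    show "AE \<omega> in M. norm ((?g n \<omega> - ?c n \<omega>)\<^sup>2) \<le> 2 * C\<^sup>2 * (?N \<omega>)\<^sup>2 + 2 * B\<^sup>2" for n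
    proof (rule AE_I2)
      fix \<omega> assume \<omega>: "\<omega> \<in> space M"
      have g2: "(?g n \<omega>)\<^sup>2 \<le> (C * ?N \<omega>)\<^sup>2"
        using power_mono[OF C(2)[OF zero_less_Suc \<omega>, of n], of 2] by simp
      have "\<bar>?c n \<omega>\<bar> \<le> B" by (rule abs_compensator_le[OF t zero_less_Suc \<omega>]) (rule B(2), auto)
      from power_mono[OF this, of 2] have c2: "(?c n \<omega>)\<^sup>2 \<le> B\<^sup>2" by simp
      have "(a - b)\<^sup>2 \<le> 2 * a\<^sup>2 + 2 * b\<^sup>2" for a b :: real
        using zero_le_power2[of "a + b"] by (simp add: power2_eq_square algebra_simps)
      from this[of "?g n \<omega>" "?c n \<omega>"] g2 c2
      show "norm ((?g n \<omega> - ?c n \<omega>)\<^sup>2) \<le> 2 * C\<^sup>2 * (?N \<omega>)\<^sup>2 + 2 * B\<^sup>2"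
        by (simp add: power_mult_distrib)
    qed
  qed
  have "(\<lambda>n. \<Sum>m<Suc n. expectation (\<lambda>\<omega>. (step_mean (t / real (Suc n)) f (grid t (Suc n) \<omega> m))\<^sup>2)) \<longlonglongrightarrow> 0"
  proof (rule Lim_null_comparison)
    show "(\<lambda>n. B\<^sup>2 / real (Suc n)) \<longlonglongrightarrow> 0"
      by (rule LIMSEQ_Suc[OF lim_const_over_n])
    show "\<forall>\<^sub>F n in sequentially. norm (\<Sum>m<Suc n. expectation (\<lambda>\<omega>. (step_mean (t / real (Suc n)) f (grid t (Suc n) \<omega> m))\<^sup>2)) \<le> B\<^sup>2 / real (Suc n)"
    proof (rule always_eventually, rule allI)
      fix n
      let ?e = "\<lambda>m \<omega>. (step_mean (t / real (Suc n)) f (grid t (Suc n) \<omega> m))\<^sup>2"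
      have e: "expectation (?e m) \<le> (B / real (Suc n))\<^sup>2" for m
      proof -
        have "expectation (?e m) \<le> expectation (\<lambda>_. (B / real (Suc n))\<^sup>2)"
        proof (rule integral_mono)
          show "integrable M (?e m)"
            by (rule integrable_grid[OF t zero_less_Suc, where l = m and \<Phi> = "\<lambda>y. (step_mean (t / real (Suc n)) f (y m))\<^sup>2"]) simp
          fix \<omega> assume "\<omega> \<in> space M"
          then have "\<bar>step_mean (t / real (Suc n)) f (grid t (Suc n) \<omega> m)\<bar> \<le> B / real (Suc n)"
            by (intro B(2) grid_in_S t zero_less_Suc)
          from power_mono[OF this, of 2] show "?e m \<omega> \<le> (B / real (Suc n))\<^sup>2" by simp
        qed simp
        then show ?thesis by (simp add: prob_space)
      qed
      have "(\<Sum>m<Suc n. expectation (?e m)) \<le> (\<Sum>m<Suc n. (B / real (Suc n))\<^sup>2)"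
        using e by (rule sum_mono)
      also have "\<dots> = B\<^sup>2 / real (Suc n)" by (simp add: power2_eq_square)
      finally show "norm (\<Sum>m<Suc n. expectation (?e m)) \<le> B\<^sup>2 / real (Suc n)"
        unfolding real_norm_def
        by (subst abs_of_nonneg) (intro sum_nonneg Bochner_Integration.integral_nonneg zero_le_power2)
    qed
  qed
  with expectation_grid_sum_tendsto[OF t, of "\<lambda>i j. (f i j)\<^sup>2"]
  have "(\<lambda>n. expectation (\<lambda>\<omega>. grid_sum (\<lambda>i j. (f i j)\<^sup>2) (path \<omega>) t (Suc n)) -
      (\<Sum>m<Suc n. expectation (\<lambda>\<omega>. (step_mean (t / real (Suc n)) f (grid t (Suc n) \<omega> m))\<^sup>2)))
      \<longlonglongrightarrow> expectation (\<lambda>\<omega>. jump_sum (\<lambda>i j. (f i j)\<^sup>2) (path \<omega>) t) - 0"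
    by (intro tendsto_diff) (simp_all add: f0)
  then have lim2: "(\<lambda>n. expectation (\<lambda>\<omega>. (?g n \<omega> - ?c n \<omega>)\<^sup>2)) \<longlonglongrightarrow>
      expectation (\<lambda>\<omega>. jump_sum (\<lambda>i j. (f i j)\<^sup>2) (path \<omega>) t)"
    by (simp only: expectation_compensated_square[OF t zero_less_Suc] diff_zero)
  show ?thesis using LIMSEQ_unique[OF lim1 lim2] .
qed

end

section \<open>Sums of conditionally independent Bernoulli marks\<close>

text \<open>Given \<open>F\<close>, which determines \<open>n\<close>, the sum \<open>N\<close> of the first \<open>n\<close> marks is a sum of
  independent Bernoulli variables with parameters \<open>r k\<close>. Its conditional mean is \<open>A\<close> and its
  conditional variance is \<open>A - B\<close>. Measurability is assumed of the sums \<open>A\<close> and \<open>B\<close>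
  rather than of the single \<open>r k\<close>, because the sums are limits of grid sums and hence easily seen
  to be measurable. The identities hold for the sums truncated at a fixed number \<open>K\<close> of marks, by
  conditioning each mark and each pair of marks on \<open>F\<close>, and pass to the limit
  \<open>K \<longlonglongrightarrow> \<infinity>\<close> with \<open>n\<close> and \<open>n\<^sup>2\<close> as bounds.\<close>

lemma bernoulli_sum_moments:
  fixes M F :: "'a measure" and X :: "nat \<Rightarrow> 'a \<Rightarrow> bool" and n :: "'a \<Rightarrow> nat"
    and r :: "nat \<Rightarrow> 'a \<Rightarrow> real"
  assumes "prob_space M" and sub: "subalgebra M F"
    and n_meas: "n \<in> F \<rightarrow>\<^sub>M count_space UNIV"
    and indep: "cond_indep_vars M F (\<lambda>_. count_space UNIV) X UNIV"
    and cond: "\<And>k. AE \<omega> in M. k < n \<omega> \<longrightarrow>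
      real_cond_exp M F (indicator {\<omega> \<in> space M. X k \<omega>}) \<omega> = r k \<omega>"
    and r01: "\<forall>\<omega>\<in>space M. \<forall>k<n \<omega>. 0 \<le> r k \<omega> \<and> r k \<omega> \<le> 1"
    and n_int: "integrable M (\<lambda>\<omega>. (real (n \<omega>))\<^sup>2)"
    and A_meas: "(\<lambda>\<omega>. \<Sum>k<n \<omega>. r k \<omega>) \<in> borel_measurable M"
    and B_meas: "(\<lambda>\<omega>. \<Sum>k<n \<omega>. (r k \<omega>)\<^sup>2) \<in> borel_measurable M"
  defines "N \<equiv> \<lambda>\<omega>. \<Sum>k<n \<omega>. of_bool (X k \<omega>) :: real"
    and "A \<equiv> \<lambda>\<omega>. \<Sum>k<n \<omega>. r k \<omega>" and "B \<equiv> \<lambda>\<omega>. \<Sum>k<n \<omega>. (r k \<omega>)\<^sup>2"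
  shows "integrable M N" and "integrable M (\<lambda>\<omega>. (N \<omega>)\<^sup>2)"
    and "integral\<^sup>L M N = integral\<^sup>L M A"
    and "integral\<^sup>L M (\<lambda>\<omega>. (N \<omega>)\<^sup>2) = integral\<^sup>L M (\<lambda>\<omega>. A \<omega> + (A \<omega>)\<^sup>2 - B \<omega>)"
proof -
  interpret prob_space M by fact
  interpret finite_measure_subalgebra M F by unfold_locales (rule sub)
  let ?ce = "real_cond_exp M F"
  define H :: "nat \<Rightarrow> 'a \<Rightarrow> real" where "H k \<omega> = (if k < n \<omega> then 1 else 0)" for k \<omega>
  define U :: "nat \<Rightarrow> 'a \<Rightarrow> real" where "U k = indicator {\<omega> \<in> space M. X k \<omega>}" for k
  define Z where "Z k \<omega> = H k \<omega> * ?ce (U k) \<omega>" for k \<omega>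
  have HF: "H k \<in> borel_measurable F" for k
  proof -
    have "(\<lambda>i. if k < i then 1 else 0 :: real) \<in> count_space UNIV \<rightarrow>\<^sub>M borel" by simp
    from measurable_compose[OF n_meas this] show ?thesis by (simp add: H_def[abs_def])
  qed
  have HM: "H k \<in> borel_measurable M" for k by (rule measurable_from_subalg[OF sub HF])
  have X: "X k \<in> M \<rightarrow>\<^sub>M count_space UNIV" for k
    using indep unfolding cond_indep_vars_def by blast
  have XM: "{\<omega> \<in> space M. X k \<omega>} \<in> events" for k
  proof -
    have "X k -` {True} \<inter> space M \<in> events" by (rule measurable_sets[OF X]) simp
    moreover have "X k -` {True} \<inter> space M = {\<omega> \<in> space M. X k \<omega>}" by auto
    ultimately show ?thesis by simp
  qed
  have UM: "U k \<in> borel_measurable M" for k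
    unfolding U_def by (rule borel_measurable_indicator[OF XM])
  have ceM: "?ce g \<in> borel_measurable M" for g
    by (rule borel_measurable_cond_exp2)
  have ZM: "Z k \<in> borel_measurable M" for k
    unfolding Z_def[abs_def] by (intro borel_measurable_times HM ceM)
  have HU: "\<bar>H k \<omega> * U k \<omega>\<bar> \<le> 1" for k \<omega> by (simp add: H_def U_def indicator_def)
  have bnd: "integrable M g" if "g \<in> borel_measurable M" "AE \<omega> in M. \<bar>g \<omega>\<bar> \<le> 1" for g :: "'a \<Rightarrow> real"
    using that by (intro integrable_const_bound[where B = 1]) auto
  have AEr: "AE \<omega> in M. \<forall>k. Z k \<omega> = (if k < n \<omega> then r k \<omega> else 0)"
  proof (subst AE_all_countable, rule allI)
    fix k
    show "AE \<omega> in M. Z k \<omega> = (if k < n \<omega> then r k \<omega> else 0)"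
      using cond[of k] by eventually_elim (simp add: Z_def H_def U_def)
  qed
  have Z01: "AE \<omega> in M. \<forall>k. 0 \<le> Z k \<omega> \<and> Z k \<omega> \<le> 1"
    using AEr AE_space by eventually_elim (use r01 in auto)
  have intHU: "integrable M (\<lambda>\<omega>. H k \<omega> * U k \<omega>)" for k
    using HU by (intro bnd borel_measurable_times HM UM) auto
  have intHU2: "integrable M (\<lambda>\<omega>. H k \<omega> * H l \<omega> * (U k \<omega> * U l \<omega>))" for k l
    by (intro bnd borel_measurable_times HM UM AE_I2) (simp add: H_def U_def indicator_def)
  have intZ: "integrable M (Z k)" for k
    by (rule bnd[OF ZM]) (use Z01 in eventually_elim, auto)
  have intZ2: "integrable M (\<lambda>\<omega>. Z k \<omega> * Z l \<omega>)" for k l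
  proof (intro bnd borel_measurable_times ZM)
    show "AE \<omega> in M. \<bar>Z k \<omega> * Z l \<omega>\<bar> \<le> 1"
      using Z01 by eventually_elim (auto simp: abs_mult intro!: mult_le_one)
  qed
  have one: "integral\<^sup>L M (\<lambda>\<omega>. H k \<omega> * U k \<omega>) = integral\<^sup>L M (Z k)" for k
    using real_cond_exp_intg(2)[OF intHU[of k] HF UM] by (simp add: Z_def[abs_def])
  have two: "integral\<^sup>L M (\<lambda>\<omega>. H k \<omega> * H l \<omega> * (U k \<omega> * U l \<omega>)) = integral\<^sup>L M (\<lambda>\<omega>. Z k \<omega> * Z l \<omega>)"
    if kl: "k \<noteq> l" for k l
  proof -
    let ?V = "indicator {\<omega> \<in> space M. \<forall>i\<in>{k, l}. X i \<omega> \<in> {True}} :: 'a \<Rightarrow> real"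
    have V: "?V = (\<lambda>\<omega>. U k \<omega> * U l \<omega>)" by (auto simp: U_def indicator_def fun_eq_iff)
    have "\<forall>K A. finite K \<longrightarrow> K \<subseteq> UNIV \<longrightarrow> (\<forall>i\<in>K. A i \<in> sets (count_space (UNIV :: bool set))) \<longrightarrow>
        (AE \<omega> in M. ?ce (indicator {\<omega>\<in>space M. \<forall>i\<in>K. X i \<omega> \<in> A i}) \<omega> =
           (\<Prod>i\<in>K. ?ce (indicator {\<omega>\<in>space M. X i \<omega> \<in> A i}) \<omega>))"
      using indep unfolding cond_indep_vars_def by (rule conjunct2)
    from this[rule_format, of "{k, l}" "\<lambda>_. {True}"]
    have "AE \<omega> in M. ?ce ?V \<omega> = (\<Prod>i\<in>{k, l}. ?ce (indicator {\<omega>\<in>space M. X i \<omega> \<in> {True}}) \<omega>)"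
      by simp
    then have ceV: "AE \<omega> in M. ?ce ?V \<omega> = ?ce (U k) \<omega> * ?ce (U l) \<omega>"
      using kl by (simp add: U_def)
    have "integral\<^sup>L M (\<lambda>\<omega>. H k \<omega> * H l \<omega> * (U k \<omega> * U l \<omega>)) =
        integral\<^sup>L M (\<lambda>\<omega>. H k \<omega> * H l \<omega> * ?ce ?V \<omega>)"
      unfolding V
      by (rule real_cond_exp_intg(2)[symmetric]) (intro intHU2 borel_measurable_times HF UM)+
    also have "\<dots> = integral\<^sup>L M (\<lambda>\<omega>. Z k \<omega> * Z l \<omega>)"
    proof (rule integral_cong_AE)
      show "AE \<omega> in M. H k \<omega> * H l \<omega> * ?ce ?V \<omega> = Z k \<omega> * Z l \<omega>"
        using ceV by eventually_elim (simp add: Z_def)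
    qed (intro borel_measurable_times HM ceM ZM)+
    finally show ?thesis .
  qed
  define NK where "NK K \<omega> = (\<Sum>k<K. H k \<omega> * U k \<omega>)" for K \<omega>
  define AK where "AK K \<omega> = (\<Sum>k<K. Z k \<omega>)" for K \<omega>
  define BK where "BK K \<omega> = (\<Sum>k<K. (Z k \<omega>)\<^sup>2)" for K \<omega>
  have NKM: "NK K \<in> borel_measurable M" for K
    unfolding NK_def[abs_def] by (intro borel_measurable_sum borel_measurable_times HM UM)
  have AKM: "AK K \<in> borel_measurable M" for K
    unfolding AK_def[abs_def] by (intro borel_measurable_sum ZM)
  have BKM: "BK K \<in> borel_measurable M" for K
    unfolding BK_def[abs_def] by (intro borel_measurable_sum borel_measurable_power ZM)
  have E1: "integral\<^sup>L M (NK K) = integral\<^sup>L M (AK K)" for K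
    unfolding NK_def[abs_def] AK_def[abs_def]
    using one intHU intZ by (simp add: Bochner_Integration.integral_sum)
  have square: "(\<Sum>k<K. u k)\<^sup>2 = (\<Sum>k<K. \<Sum>l<K. u k * u l)" for u :: "nat \<Rightarrow> real" and K
    by (simp add: power2_eq_square sum_product)
  have E2: "integral\<^sup>L M (\<lambda>\<omega>. (NK K \<omega>)\<^sup>2) = integral\<^sup>L M (\<lambda>\<omega>. AK K \<omega> + (AK K \<omega>)\<^sup>2 - BK K \<omega>)" for K
  proof -
    let ?n = "\<lambda>k l \<omega>. if k = l then H k \<omega> * U k \<omega> else H k \<omega> * H l \<omega> * (U k \<omega> * U l \<omega>)"
    let ?z = "\<lambda>k l \<omega>. if k = l then Z k \<omega> else Z k \<omega> * Z l \<omega>"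
    have double: "integral\<^sup>L M (\<lambda>\<omega>. \<Sum>k<K. \<Sum>l<K. \<phi> k l \<omega>) = (\<Sum>k<K. \<Sum>l<K. integral\<^sup>L M (\<phi> k l))"
      if "\<And>k l. integrable M (\<phi> k l)" for \<phi> :: "nat \<Rightarrow> nat \<Rightarrow> 'a \<Rightarrow> real"
      using that by (simp add: Bochner_Integration.integral_sum Bochner_Integration.integrable_sum)
    have iN: "integrable M (?n k l)" for k l
      using intHU intHU2 by (cases "k = l") simp_all
    have iZ: "integrable M (?z k l)" for k l
      using intZ intZ2 by (cases "k = l") simp_all
    have "(NK K \<omega>)\<^sup>2 = (\<Sum>k<K. \<Sum>l<K. ?n k l \<omega>)" for \<omega>
      unfolding NK_def square
      by (intro sum.cong refl) (auto simp: H_def U_def indicator_def)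
    then have "integral\<^sup>L M (\<lambda>\<omega>. (NK K \<omega>)\<^sup>2) = (\<Sum>k<K. \<Sum>l<K. integral\<^sup>L M (?n k l))"
      by (simp only: double[OF iN])
    also have "\<dots> = (\<Sum>k<K. \<Sum>l<K. integral\<^sup>L M (?z k l))"
    proof (intro sum.cong refl)
      fix k l
      show "integral\<^sup>L M (?n k l) = integral\<^sup>L M (?z k l)"
        using one[of k] two[of k l] by (cases "k = l") simp_all
    qed
    also have "\<dots> = integral\<^sup>L M (\<lambda>\<omega>. \<Sum>k<K. \<Sum>l<K. ?z k l \<omega>)"
      by (simp only: double[OF iZ])
    also have "(\<lambda>\<omega>. \<Sum>k<K. \<Sum>l<K. ?z k l \<omega>) = (\<lambda>\<omega>. AK K \<omega> + (AK K \<omega>)\<^sup>2 - BK K \<omega>)"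
    proof
      fix \<omega>
      have "(\<Sum>k<K. \<Sum>l<K. ?z k l \<omega>) =
          (\<Sum>k<K. \<Sum>l<K. Z k \<omega> * Z l \<omega> + (if k = l then Z k \<omega> - (Z k \<omega>)\<^sup>2 else 0))"
        by (intro sum.cong refl) (auto simp: power2_eq_square)
      also have "\<dots> = (AK K \<omega>)\<^sup>2 + (\<Sum>k<K. Z k \<omega> - (Z k \<omega>)\<^sup>2)"
        by (simp add: sum.distrib AK_def square)
      finally show "(\<Sum>k<K. \<Sum>l<K. ?z k l \<omega>) = AK K \<omega> + (AK K \<omega>)\<^sup>2 - BK K \<omega>"
        by (simp add: AK_def BK_def sum_subtractf)
    qed
    finally show ?thesis .
  qed
  \<comment> \<open>A sum truncated at \<open>K\<close> is complete as soon as \<open>K\<close> exceeds the number of marks.\<close>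
  have trunc: "(\<Sum>k<K. if k < m then u k else 0) = (\<Sum>k<m. u k)" if "m \<le> K" for m K and u :: "nat \<Rightarrow> real"
  proof -
    have "{..<K} \<inter> {k. k < m} = {..<m}" using that by auto
    then show ?thesis by (simp add: sum.If_cases)
  qed
  have bound: "\<bar>\<Sum>k<K. if k < m then u k else 0\<bar> \<le> real m"
    if u: "\<And>k. k < m \<Longrightarrow> 0 \<le> u k \<and> u k \<le> 1" for m K and u :: "nat \<Rightarrow> real"
  proof -
    have "\<bar>\<Sum>k<K. if k < m then u k else 0\<bar> \<le> (\<Sum>k<K. if k < m then 1 else 0)"
      using u by (intro order_trans[OF sum_abs] sum_mono) auto
    also have "\<dots> = real (card ({..<K} \<inter> {k. k < m}))" by (simp add: sum.If_cases)
    also have "\<dots> \<le> real (card {..<m})" by (intro of_nat_mono card_mono) auto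
    finally show ?thesis by simp
  qed
  have NKeq: "NK K \<omega> = (\<Sum>k<K. if k < n \<omega> then of_bool (X k \<omega>) else 0)" if "\<omega> \<in> space M" for K \<omega>
    unfolding NK_def using that by (intro sum.cong) (auto simp: H_def U_def)
  have NKlim: "(\<lambda>K. NK K \<omega>) \<longlonglongrightarrow> N \<omega>" if "\<omega> \<in> space M" for \<omega>
    unfolding N_def NKeq[OF that]
    by (rule tendsto_eventually, use eventually_ge_at_top[of "n \<omega>"] in eventually_elim) (rule trunc)
  have NKb: "\<bar>NK K \<omega>\<bar> \<le> real (n \<omega>)" if "\<omega> \<in> space M" for K \<omega>
    unfolding NKeq[OF that] by (rule bound) simp
  have AKlim: "AE \<omega> in M. (\<lambda>K. AK K \<omega>) \<longlonglongrightarrow> A \<omega> \<and> (\<forall>K. \<bar>AK K \<omega>\<bar> \<le> real (n \<omega>))"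
    using AEr AE_space
  proof eventually_elim
    case (elim \<omega>)
    have eq: "AK K \<omega> = (\<Sum>k<K. if k < n \<omega> then r k \<omega> else 0)" for K using elim by (simp add: AK_def)
    have "(\<lambda>K. AK K \<omega>) \<longlonglongrightarrow> A \<omega>"
      unfolding A_def eq
      by (rule tendsto_eventually, use eventually_ge_at_top[of "n \<omega>"] in eventually_elim) (rule trunc)
    moreover have "\<bar>AK K \<omega>\<bar> \<le> real (n \<omega>)" for K
      unfolding eq by (rule bound) (use r01 elim in auto)
    ultimately show ?case by blast
  qed
  have BKlim: "AE \<omega> in M. (\<lambda>K. BK K \<omega>) \<longlonglongrightarrow> B \<omega> \<and> (\<forall>K. \<bar>BK K \<omega>\<bar> \<le> real (n \<omega>))"
    using AEr AE_space
  proof eventually_elim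
    case (elim \<omega>)
    have eq: "BK K \<omega> = (\<Sum>k<K. if k < n \<omega> then (r k \<omega>)\<^sup>2 else 0)" for K
      using elim by (auto simp: BK_def intro!: sum.cong)
    have "(\<lambda>K. BK K \<omega>) \<longlonglongrightarrow> B \<omega>"
      unfolding B_def eq
      by (rule tendsto_eventually, use eventually_ge_at_top[of "n \<omega>"] in eventually_elim) (rule trunc)
    moreover have "\<bar>BK K \<omega>\<bar> \<le> real (n \<omega>)" for K
      unfolding eq by (rule bound) (use r01 elim in \<open>auto simp: power_le_one\<close>)
    ultimately show ?case by blast
  qed
  have AM: "A \<in> borel_measurable M" using A_meas by (simp add: A_def)
  have BM: "B \<in> borel_measurable M" using B_meas by (simp add: B_def)
  have NM: "N \<in> borel_measurable M"
    by (rule borel_measurable_LIMSEQ_real[OF NKlim NKM])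
  have nn: "real m \<le> (real m)\<^sup>2" for m
    by (cases m) (simp_all add: power2_eq_square)
  have n_int1: "integrable M (\<lambda>\<omega>. real (n \<omega>))"
  proof (rule Bochner_Integration.integrable_bound[OF n_int])
    have "real \<in> count_space UNIV \<rightarrow>\<^sub>M borel" by simp
    from measurable_compose[OF measurable_from_subalg[OF sub n_meas] this]
    show "(\<lambda>\<omega>. real (n \<omega>)) \<in> borel_measurable M" .
  qed (use nn in simp)
  have Nb: "\<bar>N \<omega>\<bar> \<le> real (n \<omega>)" if "\<omega> \<in> space M" for \<omega>
    using tendsto_upperbound[OF tendsto_rabs[OF NKlim[OF that]] always_eventually] NKb[OF that] by auto
  show "integrable M N"
    by (rule Bochner_Integration.integrable_bound[OF n_int1 NM]) (use Nb in auto)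
  show "integrable M (\<lambda>\<omega>. (N \<omega>)\<^sup>2)"
  proof (rule Bochner_Integration.integrable_bound[OF n_int])
    show "AE \<omega> in M. norm ((N \<omega>)\<^sup>2) \<le> norm ((real (n \<omega>))\<^sup>2)"
    proof (rule AE_I2)
      fix \<omega> assume "\<omega> \<in> space M"
      from power_mono[OF Nb[OF this], of 2] show "norm ((N \<omega>)\<^sup>2) \<le> norm ((real (n \<omega>))\<^sup>2)" by simp
    qed
  qed (intro borel_measurable_power NM)
  have "(\<lambda>K. integral\<^sup>L M (NK K)) \<longlonglongrightarrow> integral\<^sup>L M N"
    by (rule integral_dominated_convergence[OF NM NKM n_int1]) (use NKlim NKb in auto)
  moreover have "(\<lambda>K. integral\<^sup>L M (AK K)) \<longlonglongrightarrow> integral\<^sup>L M A"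
    by (rule integral_dominated_convergence[OF AM AKM n_int1]) (use AKlim in \<open>eventually_elim, simp\<close>)+
  ultimately show "integral\<^sup>L M N = integral\<^sup>L M A"
    unfolding E1 by (rule LIMSEQ_unique)
  have "(\<lambda>K. integral\<^sup>L M (\<lambda>\<omega>. (NK K \<omega>)\<^sup>2)) \<longlonglongrightarrow> integral\<^sup>L M (\<lambda>\<omega>. (N \<omega>)\<^sup>2)"
  proof (rule integral_dominated_convergence[OF _ _ n_int])
    show "AE \<omega> in M. (\<lambda>K. (NK K \<omega>)\<^sup>2) \<longlonglongrightarrow> (N \<omega>)\<^sup>2"
      by (intro AE_I2 tendsto_power NKlim)
    show "AE \<omega> in M. norm ((NK K \<omega>)\<^sup>2) \<le> (real (n \<omega>))\<^sup>2" for K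
    proof (rule AE_I2)
      fix \<omega> assume "\<omega> \<in> space M"
      from power_mono[OF NKb[OF this, of K], of 2] show "norm ((NK K \<omega>)\<^sup>2) \<le> (real (n \<omega>))\<^sup>2" by simp
    qed
  qed (intro borel_measurable_power NM NKM)+
  moreover have "(\<lambda>K. integral\<^sup>L M (\<lambda>\<omega>. AK K \<omega> + (AK K \<omega>)\<^sup>2 - BK K \<omega>)) \<longlonglongrightarrow>
      integral\<^sup>L M (\<lambda>\<omega>. A \<omega> + (A \<omega>)\<^sup>2 - B \<omega>)"
  proof (rule integral_dominated_convergence[where w = "\<lambda>\<omega>. 3 * (real (n \<omega>))\<^sup>2"])
    show "AE \<omega> in M. (\<lambda>K. AK K \<omega> + (AK K \<omega>)\<^sup>2 - BK K \<omega>) \<longlonglongrightarrow> A \<omega> + (A \<omega>)\<^sup>2 - B \<omega>"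
      using AKlim BKlim by eventually_elim (intro tendsto_intros; simp)
    show "AE \<omega> in M. norm (AK K \<omega> + (AK K \<omega>)\<^sup>2 - BK K \<omega>) \<le> 3 * (real (n \<omega>))\<^sup>2" for K
      using AKlim BKlim
    proof eventually_elim
      case (elim \<omega>)
      then have a: "\<bar>AK K \<omega>\<bar> \<le> real (n \<omega>)" and b: "\<bar>BK K \<omega>\<bar> \<le> real (n \<omega>)" by blast+
      have "(AK K \<omega>)\<^sup>2 \<le> (real (n \<omega>))\<^sup>2" using power_mono[OF a, of 2] by simp
      moreover have "0 \<le> (AK K \<omega>)\<^sup>2" by simp
      ultimately show ?case unfolding real_norm_def using a b nn[of "n \<omega>"] by linarith
    qed
    show "integrable M (\<lambda>\<omega>. 3 * (real (n \<omega>))\<^sup>2)" using n_int by simp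
  qed (intro borel_measurable_diff borel_measurable_add borel_measurable_power AM BM AKM BKM)+
  ultimately show "integral\<^sup>L M (\<lambda>\<omega>. (N \<omega>)\<^sup>2) = integral\<^sup>L M (\<lambda>\<omega>. A \<omega> + (A \<omega>)\<^sup>2 - B \<omega>)"
    unfolding E2 by (rule LIMSEQ_unique)
qed

section \<open>Enumeration of births and deaths\<close>

definition event_count :: "(real \<Rightarrow> nat) \<Rightarrow> real \<Rightarrow> nat" where
  "event_count x t = card ((births x \<union> deaths x) \<inter> {0<..t})"

lemma births_deaths_subset_jumps: "births x \<union> deaths x \<subseteq> jumps x"
  by (auto simp: births_def deaths_def jumps_def)

lemma finite_events:
  assumes "step_path x"
  shows "finite ((births x \<union> deaths x) \<inter> {0<..t})" and "finite (events_before x t)"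
proof -
  show "finite ((births x \<union> deaths x) \<inter> {0<..t})"
    by (rule finite_subset[OF _ finite_jumps[OF assms, of t]]) (use births_deaths_subset_jumps in blast)
  then show "finite (events_before x t)"
    by (rule rev_finite_subset) (auto simp: events_before_def)
qed

text \<open>The number of earlier events is strictly increasing along the events, so it numbers them
  from 0 in order of time, and \<open>event_time\<close> is the inverse of this numbering.\<close>

lemma card_events_before_less:
  assumes x: "step_path x" and s: "s \<in> births x \<union> deaths x" and u: "s < u"
  shows "card (events_before x s) < card (events_before x u)"
proof (rule psubset_card_mono[OF finite_events(2)[OF x]])
  have "0 < s" using s by (auto simp: births_def deaths_def)
  then have "s \<in> events_before x u" "s \<notin> events_before x s" using s u by (auto simp: events_before_def)
  moreover have "events_before x s \<subseteq> events_before x u" using u by (auto simp: events_before_def)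
  ultimately show "events_before x s \<subset> events_before x u" by blast
qed

lemma event_time_card_events_before:
  assumes x: "step_path x" and s: "s \<in> births x \<union> deaths x"
  shows "event_time x (card (events_before x s)) = s"
  unfolding event_time_def
proof (rule the_equality)
  fix u assume u: "u \<in> births x \<union> deaths x \<and> card (events_before x u) = card (events_before x s)"
  show "u = s"
    using card_events_before_less[OF x s, of u] card_events_before_less[OF x conjunct1[OF u], of s]
      conjunct2[OF u] by (metis less_irrefl linorder_less_linear)
qed (use s in simp)

lemma bij_betw_event_time:
  assumes x: "step_path x"
  shows "bij_betw (event_time x) {..<event_count x t} ((births x \<union> deaths x) \<inter> {0<..t})"
proof -
  let ?E = "(births x \<union> deaths x) \<inter> {0<..t}" and ?r = "\<lambda>s. card (events_before x s)"
  have et: "event_time x (?r s) = s" if "s \<in> ?E" for s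
    using that by (intro event_time_card_events_before[OF x]) blast
  have inj: "inj_on ?r ?E" by (rule inj_on_inverseI[where g = "event_time x"]) (rule et)
  have "?r ` ?E \<subseteq> {..<event_count x t}"
  proof (rule image_subsetI)
    fix s assume s: "s \<in> ?E"
    have "events_before x s \<subset> ?E" using s by (auto simp: events_before_def)
    then show "?r s \<in> {..<event_count x t}"
      unfolding event_count_def lessThan_iff by (rule psubset_card_mono[OF finite_events(1)[OF x]])
  qed
  moreover have "card (?r ` ?E) = card {..<event_count x t}"
    by (simp add: card_image[OF inj] event_count_def)
  ultimately have im: "?r ` ?E = {..<event_count x t}"
    by (intro card_subset_eq) auto
  then have "\<forall>k\<in>{..<event_count x t}. ?r (event_time x k) = k"
    unfolding im[symmetric] using et by simp
  moreover have "event_time x ` {..<event_count x t} \<subseteq> ?E"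
    unfolding im[symmetric] using et by auto
  ultimately show ?thesis
    by (intro bij_betw_byWitness[where f' = ?r]) (use et im in auto)
qed

lemma event_count_le:
  assumes x: "step_path x"
  shows "event_count x t \<le> card (events_before x (t + 1))"
  unfolding event_count_def
  by (rule card_mono[OF finite_events(2)[OF x]]) (auto simp: events_before_def)

text \<open>The marks are read off at time \<open>t + 1\<close>, whose strict past contains all of
  \<open>(0, t]\<close>, the endpoint \<open>t\<close> included. The choice of 1 is arbitrary.\<close>

lemma thinned_count_eq_sum_marks:
  assumes x: "step_path (\<lambda>s. Q s \<omega>)"
  shows "thinned_count Q Jp Jm t \<omega> =
    (\<Sum>k<event_count (\<lambda>s. Q s \<omega>) t. of_bool (mark_before Q Jp Jm (t + 1) k \<omega>))"
proof -
  let ?x = "\<lambda>s. Q s \<omega>"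
  let ?E = "(births ?x \<union> deaths ?x) \<inter> {0<..t}"
  let ?j = "\<lambda>s. if s \<in> births ?x then Jp s \<omega> else Jm s \<omega>"
  have "?E = (births ?x \<inter> {0<..t}) \<union> (deaths ?x \<inter> {0<..t})" by blast
  moreover have "(births ?x \<inter> {0<..t}) \<inter> (deaths ?x \<inter> {0<..t}) = {}"
    by (auto simp: births_def deaths_def)
  ultimately have "(\<Sum>s\<in>?E. of_bool (?j s)) =
      (\<Sum>s\<in>births ?x \<inter> {0<..t}. of_bool (?j s)) + (\<Sum>s\<in>deaths ?x \<inter> {0<..t}. of_bool (?j s) :: real)"
    using finite_events(1)[OF x, of t] by (simp only: sum.union_disjoint finite_Un)
  also have "\<dots> = thinned_count Q Jp Jm t \<omega>"
    unfolding thinned_count_def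
    by (intro arg_cong2[where f = "(+)"] sum.cong refl) (auto simp: births_def deaths_def)
  finally have "thinned_count Q Jp Jm t \<omega> = (\<Sum>s\<in>?E. of_bool (?j s))" by simp
  also have "\<dots> = (\<Sum>k<event_count ?x t. of_bool (?j (event_time ?x k)))"
    by (rule sum.reindex_bij_betw[OF bij_betw_event_time[OF x], symmetric])
  also have "\<dots> = (\<Sum>k<event_count ?x t. of_bool (mark_before Q Jp Jm (t + 1) k \<omega>))"
    using event_count_le[OF x, of t] by (intro sum.cong refl) (simp add: mark_before_def Let_def)
  finally show ?thesis .
qed

definition mark_rate :: "(nat \<Rightarrow> real) \<Rightarrow> (nat \<Rightarrow> real) \<Rightarrow> nat \<Rightarrow> nat \<Rightarrow> real" where
  "mark_rate qp qm i j = (if j = i + 1 then qp i else if j + 1 = i then qm i else 0)"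

lemma jump_sum_events:
  assumes x: "step_path x" and f0: "\<And>i j. j \<noteq> i + 1 \<Longrightarrow> j + 1 \<noteq> i \<Longrightarrow> f i j = 0"
  shows "jump_sum f x t = (\<Sum>k<event_count x t. f (left_state x (event_time x k)) (x (event_time x k)))"
proof -
  have "jump_sum f x t = (\<Sum>s\<in>(births x \<union> deaths x) \<inter> {0<..t}. f (left_state x s) (x s))"
    unfolding jump_sum_def
    by (rule sum.mono_neutral_right[OF finite_jumps[OF x]])
      (auto simp: births_def deaths_def jumps_def intro!: f0)
  also have "\<dots> = (\<Sum>k<event_count x t. f (left_state x (event_time x k)) (x (event_time x k)))"
    by (rule sum.reindex_bij_betw[OF bij_betw_event_time[OF x], symmetric])
  finally show ?thesis .
qed

lemma mark_rate_event_time: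
  assumes x: "step_path x" and k: "k < event_count x t"
  shows "mark_rate qp qm (left_state x (event_time x k)) (x (event_time x k)) =
    thinning_prob qp qm x (event_time x k)"
proof -
  have "event_time x k \<in> births x \<union> deaths x"
    using bij_betw_event_time[OF x, of t] k unfolding bij_betw_def by blast
  then show ?thesis by (auto simp: mark_rate_def thinning_prob_def births_def deaths_def)
qed

text \<open>\<open>g\<close> will be the identity and the square. As \<open>g 0 = 0\<close>, jumps that are neither births nor
  deaths contribute nothing.\<close>

lemma jump_sum_thinning_prob:
  assumes x: "step_path x" and g0: "g 0 = (0 :: real)"
  shows "jump_sum (\<lambda>i j. g (mark_rate qp qm i j)) x t =
    (\<Sum>k<event_count x t. g (thinning_prob qp qm x (event_time x k)))"
  using mark_rate_event_time[OF x]
  by (subst jump_sum_events[OF x]) (auto simp: mark_rate_def g0 intro!: sum.cong)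

lemma event_count_eq_jump_sum:
  assumes x: "step_path x"
  shows "real (event_count x t) = jump_sum (\<lambda>i j. of_bool (j = i + 1 \<or> j + 1 = i)) x t"
proof -
  have "event_time x k \<in> births x \<union> deaths x" if "k < event_count x t" for k
    using bij_betw_event_time[OF x, of t] that unfolding bij_betw_def by blast
  then have "of_bool (x (event_time x k) = left_state x (event_time x k) + 1 \<or>
      x (event_time x k) + 1 = left_state x (event_time x k)) = (1 :: real)" if "k < event_count x t" for k
    using that by (auto simp: births_def deaths_def)
  then show ?thesis by (subst jump_sum_events[OF x]) auto
qed

section \<open>The Poisson equation of a birth-death generator\<close>

locale birth_death_rates =
  fixes J :: nat and lam mu st :: "nat \<Rightarrow> real"
  assumes lam_J: "lam J = 0" and mu_0: "mu 0 = 0"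
    and lam_pos: "\<And>i. i < J \<Longrightarrow> 0 < lam i"
    and mu_pos: "\<And>i. 0 < i \<Longrightarrow> i \<le> J \<Longrightarrow> 0 < mu i"
    and stationary: "stationary_distribution J lam mu st"
begin

lemma st_sum: "(\<Sum>i\<le>J. st i) = 1"
  using stationary unfolding stationary_distribution_def by blast

lemma st_product: "i \<le> J \<Longrightarrow> st i = st 0 * (\<Prod>k=1..i. lam (k - 1) / mu k)"
  using stationary unfolding stationary_distribution_def by blast

lemma detailed_balance:
  assumes "k < J"
  shows "st (Suc k) * mu (Suc k) = st k * lam k"
proof -
  have "{1..Suc k} = insert (Suc k) {1..k}" by auto
  then have "(\<Prod>i=1..Suc k. lam (i - 1) / mu i) = lam k / mu (Suc k) * (\<Prod>i=1..k. lam (i - 1) / mu i)"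
    by simp
  then show ?thesis
    unfolding st_product[OF less_imp_le[OF assms]] st_product[OF Suc_leI[OF assms]]
    using mu_pos[of "Suc k"] assms by simp
qed

lemma st_pos:
  assumes "i \<le> J"
  shows "0 < st i"
proof -
  have prod: "0 < (\<Prod>k=1..i. lam (k - 1) / mu k)" if "i \<le> J" for i
    using that by (intro prod_pos) (auto intro!: divide_pos_pos lam_pos mu_pos)
  have "(\<Sum>i\<le>J. st i) = (\<Sum>i\<le>J. st 0 * (\<Prod>k=1..i. lam (k - 1) / mu k))"
    by (rule sum.cong[OF refl]) (rule st_product, simp)
  then have "1 = st 0 * (\<Sum>i\<le>J. \<Prod>k=1..i. lam (k - 1) / mu k)"
    by (simp only: st_sum sum_distrib_left)
  moreover have "0 < (\<Sum>i\<le>J. \<Prod>k=1..i. lam (k - 1) / mu k)"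
    using prod by (intro sum_pos) auto
  ultimately have "0 < st 0" by (metis zero_less_mult_pos2 zero_less_one)
  then show ?thesis unfolding st_product[OF assms] by (intro mult_pos_pos prod[OF assms])
qed

definition st_mean :: "(nat \<Rightarrow> real) \<Rightarrow> real" where
  "st_mean g = (\<Sum>i\<le>J. st i * g i)"

text \<open>The numerator is the flux through the edge from \<open>k\<close> to \<open>Suc k\<close> that balances the
  centred source in the states up to \<open>k\<close>; the denominator is the stationary rate of births
  out of \<open>k\<close>.\<close>

definition increment :: "(nat \<Rightarrow> real) \<Rightarrow> nat \<Rightarrow> real" where
  "increment g k = (\<Sum>i\<le>k. st i * (st_mean g - g i)) / (st k * lam k)"

definition corrector :: "(nat \<Rightarrow> real) \<Rightarrow> nat \<Rightarrow> real" where
  "corrector g i = (\<Sum>k<i. increment g k)"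

lemma corrector_Suc: "corrector g (Suc i) = corrector g i + increment g i"
  by (simp add: corrector_def)

text \<open>Multiplied by \<open>st\<close>, the generator becomes the divergence of a flux through the
  edges between neighbouring states, by detailed balance. On a line the flux is therefore found by
  one summation, and the centring of the right-hand side makes it vanish beyond the last
  state.\<close>

lemma poisson_equation:
  assumes i: "i \<le> J"
  shows "g i + lam i * (corrector g (Suc i) - corrector g i) +
    mu i * (corrector g (i - 1) - corrector g i) = st_mean g"
proof -
  define D where "D k = (\<Sum>i\<le>k. st i * (st_mean g - g i))" for k
  have "D J = (\<Sum>i\<le>J. st i) * st_mean g - (\<Sum>i\<le>J. st i * g i)"
    by (simp only: D_def right_diff_distrib sum_subtractf sum_distrib_right)
  then have DJ: "D J = 0" by (simp add: st_sum st_mean_def)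
  have inc: "st k * lam k * increment g k = D k" if "k < J" for k
    using that st_pos[of k] lam_pos[of k] by (simp add: increment_def D_def)
  have up: "st i * lam i * (corrector g (Suc i) - corrector g i) = D i"
    using i inc[of i] DJ lam_J by (cases "i = J") (simp_all add: corrector_Suc)
  have down: "st i * mu i * (corrector g (i - 1) - corrector g i) = st i * (st_mean g - g i) - D i"
  proof (cases i)
    case 0
    then show ?thesis by (simp add: D_def mu_0)
  next
    case (Suc k)
    then have "st i * mu i * (corrector g (i - 1) - corrector g i) = - (st k * lam k * increment g k)"
      using detailed_balance[of k] i by (simp add: corrector_Suc)
    also have "\<dots> = - D k" using inc[of k] Suc i by simp
    also have "\<dots> = st i * (st_mean g - g i) - D i" by (simp add: D_def Suc)
    finally show ?thesis .
  qed
  have "st i * (g i + lam i * (corrector g (Suc i) - corrector g i) +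
      mu i * (corrector g (i - 1) - corrector g i)) =
      st i * g i + st i * lam i * (corrector g (Suc i) - corrector g i) +
      st i * mu i * (corrector g (i - 1) - corrector g i)" by (simp add: algebra_simps)
  also have "\<dots> = st i * st_mean g" unfolding up down by (simp add: algebra_simps)
  finally show ?thesis using st_pos[OF i] by simp
qed

text \<open>In equilibrium births out of \<open>k\<close> and deaths out of \<open>Suc k\<close> are equally
  frequent, so a stationary mean over jumps is a sum over edges.\<close>

lemma st_mean_edges:
  "st_mean (\<lambda>i. lam i * a i + mu i * b i) = (\<Sum>k<J. st k * lam k * (a k + b (Suc k)))"
proof -
  have "st_mean (\<lambda>i. lam i * a i + mu i * b i) = (\<Sum>i\<le>J. st i * lam i * a i) + (\<Sum>i\<le>J. st i * mu i * b i)"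
    by (simp add: st_mean_def sum.distrib distrib_left mult.assoc)
  also have "(\<Sum>i\<le>J. st i * lam i * a i) = (\<Sum>k<J. st k * lam k * a k)"
    by (simp add: lessThan_Suc_atMost[symmetric] lam_J)
  also have "(\<Sum>i\<le>J. st i * mu i * b i) = (\<Sum>k<J. st (Suc k) * mu (Suc k) * b (Suc k))"
    by (simp add: lessThan_Suc_atMost[symmetric] sum.lessThan_Suc_shift mu_0 del: sum.lessThan_Suc)
  also have "\<dots> = (\<Sum>k<J. st k * lam k * b (Suc k))"
    using detailed_balance by (intro sum.cong) auto
  finally show ?thesis by (simp add: sum.distrib distrib_left)
qed

end

section \<open>Asymptotic moments of jump functionals\<close>

lemma jump_sum_telescope:
  assumes x: "step_path x" and t: "0 < t"
  shows "jump_sum (\<lambda>i j. h j - h i) x t = h (x t) - h (x 0)"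
proof -
  have "\<forall>\<^sub>F n in sequentially. grid_sum (\<lambda>i j. h j - h i) x t n = jump_sum (\<lambda>i j. h j - h i) x t \<and> 0 < n"
    by (intro eventually_conj eventually_grid_sum_eq_jump_sum x t eventually_gt_at_top) simp
  then obtain n where n: "grid_sum (\<lambda>i j. h j - h i) x t n = jump_sum (\<lambda>i j. h j - h i) x t" "0 < n"
    using eventually_happens'[OF sequentially_bot] by blast
  have "grid_sum (\<lambda>i j. h j - h i) x t n = h (x (t / n * n)) - h (x (t / n * 0))"
    unfolding grid_sum_def using sum_lessThan_telescope[of "\<lambda>m. h (x (t / n * real m))" n] by simp
  with n show ?thesis by simp
qed

lemma jump_sum_add: "jump_sum (\<lambda>i j. f i j + g i j) x t = jump_sum f x t + jump_sum g x t"
  by (simp add: jump_sum_def sum.distrib)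

lemma tendsto_of_linear_growth:
  fixes m :: "real \<Rightarrow> real"
  assumes "\<And>t. 0 < t \<Longrightarrow> \<bar>m t - c * t\<bar> \<le> C"
  shows "((\<lambda>t. m t / t) \<longlongrightarrow> c) at_top"
proof -
  have "((\<lambda>t. m t / t - c) \<longlongrightarrow> 0) at_top"
  proof (rule Lim_null_comparison)
    show "((\<lambda>t. C / t) \<longlongrightarrow> 0) at_top"
      by (intro tendsto_divide_0[OF tendsto_const] filterlim_at_top_imp_at_infinity filterlim_ident)
    show "\<forall>\<^sub>F t in at_top. norm (m t / t - c) \<le> C / t"
      using eventually_gt_at_top[of 0]
    proof eventually_elim
      case (elim t)
      have "norm (m t / t - c) = \<bar>m t - c * t\<bar> / t" using elim by (simp add: field_simps)
      also have "\<dots> \<le> C / t" using assms[OF elim] elim by (simp add: divide_right_mono)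
      finally show ?case .
    qed
  qed
  then show ?thesis by (simp add: LIM_zero_iff)
qed

locale birth_death_process = birth_death_rates J lam mu st
  for J :: nat and lam mu st :: "nat \<Rightarrow> real" +
  fixes M :: "'a measure" and p :: "real \<Rightarrow> nat \<Rightarrow> nat \<Rightarrow> real" and Q :: "real \<Rightarrow> 'a \<Rightarrow> nat"
  assumes birth_death: "birth_death_chain M J lam mu p Q"
begin

sublocale finite_markov_chain M "{..J}" p Q "birth_death_generator lam mu"
proof
  show "markov_chain M {..J} p Q" using birth_death unfolding birth_death_chain_def by blast
  show "finite {..J}" by simp
  fix i j assume "i \<in> {..J}" "j \<in> {..J}"
  then show "((\<lambda>h. p h i j) has_real_derivative birth_death_generator lam mu i j) (at 0 within {0..})"
    using birth_death unfolding birth_death_chain_def by simp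
qed

definition rate_mean :: "(nat \<Rightarrow> nat \<Rightarrow> real) \<Rightarrow> nat \<Rightarrow> real" where
  "rate_mean f i = lam i * f i (Suc i) + mu i * f i (i - 1)"

lemma jump_rate_mean_birth_death:
  assumes i: "i \<in> {..J}" and f0: "\<And>i. f i i = 0"
  shows "jump_rate_mean f i = rate_mean f i"
proof -
  have "birth_death_generator lam mu i j * f i j =
      (if j = Suc i then lam i * f i (Suc i) else 0) + (if Suc j = i then mu i * f i (i - 1) else 0)" for j
    by (auto simp: birth_death_generator_def f0)
  then have "jump_rate_mean f i = (\<Sum>j\<le>J. if j = Suc i then lam i * f i (Suc i) else 0) +
      (\<Sum>j\<le>J. if Suc j = i then mu i * f i (i - 1) else 0)"
    by (simp add: jump_rate_mean_def sum.distrib)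
  also have "(\<Sum>j\<le>J. if j = Suc i then lam i * f i (Suc i) else 0) = lam i * f i (Suc i)"
    using i lam_J by (cases "i = J") simp_all
  also have "(\<Sum>j\<le>J. if Suc j = i then mu i * f i (i - 1) else 0) = mu i * f i (i - 1)"
    using i mu_0 by (cases i) simp_all
  finally show ?thesis by (simp add: rate_mean_def)
qed

definition corrected :: "(nat \<Rightarrow> nat \<Rightarrow> real) \<Rightarrow> nat \<Rightarrow> nat \<Rightarrow> real" where
  "corrected f i j = f i j + (corrector (rate_mean f) j - corrector (rate_mean f) i)"

definition boundary :: "(nat \<Rightarrow> nat \<Rightarrow> real) \<Rightarrow> real \<Rightarrow> 'a \<Rightarrow> real" where
  "boundary f t \<omega> = corrector (rate_mean f) (Q t \<omega>) - corrector (rate_mean f) (Q 0 \<omega>)"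

lemma corrected_diagonal: "(\<And>i. f i i = 0) \<Longrightarrow> corrected f i i = 0"
  by (simp add: corrected_def)

text \<open>Adding the increments of the corrector makes the mean rate constant in the state. On the
  level of paths it only adds a boundary term, since these increments telescope.\<close>

lemma jump_rate_mean_corrected:
  assumes f0: "\<And>i. f i i = 0" and i: "i \<in> {..J}"
  shows "jump_rate_mean (corrected f) i = st_mean (rate_mean f)"
proof -
  have "jump_rate_mean (corrected f) i = rate_mean (corrected f) i"
    by (rule jump_rate_mean_birth_death[OF i corrected_diagonal[of f, OF f0]])
  also have "\<dots> = rate_mean f i + lam i * (corrector (rate_mean f) (Suc i) - corrector (rate_mean f) i) +
      mu i * (corrector (rate_mean f) (i - 1) - corrector (rate_mean f) i)"
    unfolding rate_mean_def[of "corrected f"] rate_mean_def[of f i] by (simp add: corrected_def algebra_simps)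
  also have "\<dots> = st_mean (rate_mean f)" by (rule poisson_equation) (use i in simp)
  finally show ?thesis .
qed

lemma jump_sum_corrected:
  assumes "\<omega> \<in> space M" "0 < t"
  shows "jump_sum (corrected f) (path \<omega>) t = jump_sum f (path \<omega>) t + boundary f t \<omega>"
proof -
  have "corrected f = (\<lambda>i j. f i j + (corrector (rate_mean f) j - corrector (rate_mean f) i))"
    by (simp add: corrected_def fun_eq_iff)
  then show ?thesis
    using jump_sum_telescope[OF step_path_Q[OF assms(1)] assms(2), of "corrector (rate_mean f)"]
    by (simp add: jump_sum_add boundary_def)
qed

lemma boundary_bounded:
  obtains C where "0 \<le> C" "\<And>t \<omega>. 0 < t \<Longrightarrow> \<omega> \<in> space M \<Longrightarrow> \<bar>boundary f t \<omega>\<bar> \<le> C"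
proof -
  obtain C where C: "0 \<le> C" "\<And>i j. i \<in> {..J} \<Longrightarrow> j \<in> {..J} \<Longrightarrow>
      \<bar>corrector (rate_mean f) j - corrector (rate_mean f) i\<bar> \<le> C"
    using bounded_on_states[of "\<lambda>i j. corrector (rate_mean f) j - corrector (rate_mean f) i"] by metis
  show thesis
  proof (rule that[OF C(1)])
    fix t \<omega> assume "0 < (t::real)" "\<omega> \<in> space M"
    then show "\<bar>boundary f t \<omega>\<bar> \<le> C"
      unfolding boundary_def by (intro C(2) Q_in_S) auto
  qed
qed

lemma boundary_measurable:
  assumes "0 < t"
  shows "boundary f t \<in> borel_measurable M"
proof -
  have "(\<lambda>\<omega>. (\<lambda>i j. corrector (rate_mean f) i - corrector (rate_mean f) j) (Q t \<omega>) (Q 0 \<omega>)) \<in> borel_measurable M"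
    by (rule measurable_two_states) (use assms in \<open>auto intro: Q_measurable\<close>)
  then show ?thesis by (simp add: boundary_def[abs_def])
qed

lemma boundary_integrable:
  assumes "0 < t"
  shows "integrable M (boundary f t)"
proof -
  obtain C where "\<And>\<omega>. \<omega> \<in> space M \<Longrightarrow> \<bar>boundary f t \<omega>\<bar> \<le> C"
    using boundary_bounded[of f] assms by metis
  then show ?thesis
    by (intro integrable_const_bound[where B = C] boundary_measurable assms) auto
qed

lemma abs_expectation_boundary_le:
  assumes t: "0 < t" and C: "\<And>\<omega>. \<omega> \<in> space M \<Longrightarrow> \<bar>boundary f t \<omega>\<bar> \<le> C"
  shows "\<bar>expectation (boundary f t)\<bar> \<le> C"
proof -
  have "\<bar>expectation (boundary f t)\<bar> \<le> expectation (\<lambda>\<omega>. \<bar>boundary f t \<omega>\<bar>)"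
    by (rule integral_abs_bound)
  also have "\<dots> \<le> expectation (\<lambda>_. C)"
    using C boundary_integrable[OF t, of f] by (intro integral_mono) auto
  finally show ?thesis by (simp add: prob_space)
qed

lemma expectation_jump_sum_eq:
  assumes t: "0 < t" and f0: "\<And>i. f i i = 0"
  shows "expectation (\<lambda>\<omega>. jump_sum f (path \<omega>) t) = st_mean (rate_mean f) * t - expectation (boundary f t)"
proof -
  have "st_mean (rate_mean f) * t = expectation (\<lambda>\<omega>. jump_sum (corrected f) (path \<omega>) t)"
    by (rule expectation_jump_sum[symmetric, OF t corrected_diagonal[of f, OF f0] jump_rate_mean_corrected[of f, OF f0]])
  also have "\<dots> = expectation (\<lambda>\<omega>. jump_sum f (path \<omega>) t + boundary f t \<omega>)"
    using t by (intro Bochner_Integration.integral_cong) (simp_all add: jump_sum_corrected)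
  also have "\<dots> = expectation (\<lambda>\<omega>. jump_sum f (path \<omega>) t) + expectation (boundary f t)"
    by (intro Bochner_Integration.integral_add integrable_jump_sum t f0 boundary_integrable)
  finally show ?thesis by simp
qed

lemma expectation_jump_sum_bounded:
  assumes f0: "\<And>i. f i i = 0"
  obtains C where "0 \<le> C"
    "\<And>t. 0 < t \<Longrightarrow> \<bar>expectation (\<lambda>\<omega>. jump_sum f (path \<omega>) t) - st_mean (rate_mean f) * t\<bar> \<le> C"
proof -
  obtain C where C: "0 \<le> C" "\<And>t \<omega>. 0 < t \<Longrightarrow> \<omega> \<in> space M \<Longrightarrow> \<bar>boundary f t \<omega>\<bar> \<le> C"
    using boundary_bounded[of f] by metis
  show thesis
  proof (rule that[OF C(1)])
    fix t :: real assume t: "0 < t"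
    show "\<bar>expectation (\<lambda>\<omega>. jump_sum f (path \<omega>) t) - st_mean (rate_mean f) * t\<bar> \<le> C"
      unfolding expectation_jump_sum_eq[of t f, OF t f0]
      using abs_expectation_boundary_le[OF t C(2)[OF t]] by simp
  qed
qed

lemma expectation_jump_sum_asymptotic:
  assumes f0: "\<And>i. f i i = 0"
  shows "((\<lambda>t. expectation (\<lambda>\<omega>. jump_sum f (path \<omega>) t) / t) \<longlongrightarrow> st_mean (rate_mean f)) at_top"
proof -
  obtain C where "\<And>t. 0 < t \<Longrightarrow> \<bar>expectation (\<lambda>\<omega>. jump_sum f (path \<omega>) t) - st_mean (rate_mean f) * t\<bar> \<le> C"
    using expectation_jump_sum_bounded[of f, OF f0] by metis
  then show ?thesis by (rule tendsto_of_linear_growth)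
qed

text \<open>The boundary term is bounded while the centred functional is of order \<open>sqrt t\<close>, so
  the boundary term changes the variance by \<open>O(sqrt t)\<close> only. The cross term is split by
  \<open>2ab \<le> a\<^sup>2 / sqrt t + sqrt t b\<^sup>2\<close>.\<close>

lemma variance_jump_sum_asymptotic:
  assumes f0: "\<And>i. f i i = 0"
  shows "((\<lambda>t. variance (\<lambda>\<omega>. jump_sum f (path \<omega>) t) / t) \<longlongrightarrow>
    st_mean (rate_mean (\<lambda>i j. (corrected f i j)\<^sup>2))) at_top"
proof -
  let ?c = "st_mean (rate_mean f)" and ?v = "st_mean (rate_mean (\<lambda>i j. (corrected f i j)\<^sup>2))"
  let ?V = "\<lambda>t. variance (\<lambda>\<omega>. jump_sum f (path \<omega>) t)"
  let ?W = "\<lambda>t \<omega>. jump_sum (corrected f) (path \<omega>) t - ?c * t"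
  let ?E = "\<lambda>t. expectation (\<lambda>\<omega>. (?W t \<omega>)\<^sup>2)"
  have cf0: "corrected f i i = 0" for i by (rule corrected_diagonal[of f, OF f0])
  have E: "?E t = expectation (\<lambda>\<omega>. jump_sum (\<lambda>i j. (corrected f i j)\<^sup>2) (path \<omega>) t)" if "0 < t" for t
    by (rule expectation_jump_sum_centred_square[where f = "corrected f", OF that cf0 jump_rate_mean_corrected[of f, OF f0]])
  have "((\<lambda>t. expectation (\<lambda>\<omega>. jump_sum (\<lambda>i j. (corrected f i j)\<^sup>2) (path \<omega>) t) / t) \<longlongrightarrow> ?v) at_top"
    by (rule expectation_jump_sum_asymptotic) (simp add: cf0)
  then have Elim: "((\<lambda>t. ?E t / t) \<longlongrightarrow> ?v) at_top"
    by (rule Lim_transform_eventually) (use eventually_gt_at_top[of 0] in eventually_elim, simp add: E)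
  obtain C where C: "0 \<le> C" "\<And>t \<omega>. 0 < t \<Longrightarrow> \<omega> \<in> space M \<Longrightarrow> \<bar>boundary f t \<omega>\<bar> \<le> C"
    using boundary_bounded[of f] by metis
  have diff: "\<bar>?V t - ?E t\<bar> \<le> ?E t / sqrt t + (sqrt t + 1) * (2 * C)\<^sup>2" if t: "0 < t" for t
  proof -
    let ?d = "\<lambda>\<omega>. boundary f t \<omega> - expectation (boundary f t)"
    have iX2: "integrable M (\<lambda>\<omega>. (jump_sum f (path \<omega>) t)\<^sup>2)" by (rule integrable_jump_sum_square[of t f, OF t f0])
    have iX: "integrable M (\<lambda>\<omega>. jump_sum f (path \<omega>) t)" by (rule integrable_jump_sum[of t f, OF t f0])
    have iV: "integrable M (\<lambda>\<omega>. (jump_sum f (path \<omega>) t - expectation (\<lambda>\<omega>. jump_sum f (path \<omega>) t))\<^sup>2)"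
      using iX iX2 by (simp add: power2_diff)
    have iW: "integrable M (\<lambda>\<omega>. (?W t \<omega>)\<^sup>2)"
      using integrable_jump_sum_square[of t "corrected f", OF t cf0] integrable_jump_sum[of t "corrected f", OF t cf0]
      by (simp add: power2_diff)
    have key: "\<bar>(jump_sum f (path \<omega>) t - expectation (\<lambda>\<omega>. jump_sum f (path \<omega>) t))\<^sup>2 - (?W t \<omega>)\<^sup>2\<bar> \<le>
        (?W t \<omega>)\<^sup>2 / sqrt t + (sqrt t + 1) * (2 * C)\<^sup>2" if \<omega>: "\<omega> \<in> space M" for \<omega>
    proof -
      have X: "jump_sum f (path \<omega>) t - expectation (\<lambda>\<omega>. jump_sum f (path \<omega>) t) = ?W t \<omega> - ?d \<omega>"
        unfolding expectation_jump_sum_eq[of t f, OF t f0] jump_sum_corrected[OF \<omega> t] by simp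
      have "\<bar>?d \<omega>\<bar> \<le> 2 * C"
        using C(2)[OF t \<omega>] abs_expectation_boundary_le[OF t C(2)[OF t]] by linarith
      from power_mono[OF this, of 2] have d2: "(?d \<omega>)\<^sup>2 \<le> (2 * C)\<^sup>2" by simp
      define w where "w = ?W t \<omega>"
      define d where "d = ?d \<omega>"
      define s where "s = sqrt t"
      have s: "0 < s" using t by (simp add: s_def)
      have "0 \<le> (\<bar>w\<bar> - s * \<bar>d\<bar>)\<^sup>2 / s" using s by simp
      also have "\<dots> = w\<^sup>2 / s + s * d\<^sup>2 - 2 * (\<bar>w\<bar> * \<bar>d\<bar>)"
        using s by (simp add: power2_diff power_mult_distrib) (simp add: field_simps power2_eq_square)
      finally have cross: "2 * \<bar>w * d\<bar> \<le> w\<^sup>2 / s + s * d\<^sup>2" by (simp add: abs_mult)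
      have "\<bar>(w - d)\<^sup>2 - w\<^sup>2\<bar> = \<bar>d\<^sup>2 - 2 * (w * d)\<bar>" by (simp add: power2_diff)
      also have "\<dots> \<le> d\<^sup>2 + 2 * \<bar>w * d\<bar>"
        using abs_triangle_ineq4[of "d\<^sup>2" "2 * (w * d)"] by (simp add: abs_mult)
      also have "\<dots> \<le> w\<^sup>2 / s + (s + 1) * d\<^sup>2" using cross by (simp add: algebra_simps)
      also have "\<dots> \<le> w\<^sup>2 / s + (s + 1) * (2 * C)\<^sup>2"
        using d2 s by (intro add_left_mono mult_left_mono) (simp_all add: d_def)
      finally show ?thesis unfolding X by (simp add: w_def d_def s_def)
    qed
    have "\<bar>?V t - ?E t\<bar> = \<bar>expectation (\<lambda>\<omega>. (jump_sum f (path \<omega>) t - expectation (\<lambda>\<omega>. jump_sum f (path \<omega>) t))\<^sup>2 - (?W t \<omega>)\<^sup>2)\<bar>"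
      by (simp only: Bochner_Integration.integral_diff[OF iV iW])
    also have "\<dots> \<le> expectation (\<lambda>\<omega>. \<bar>(jump_sum f (path \<omega>) t - expectation (\<lambda>\<omega>. jump_sum f (path \<omega>) t))\<^sup>2 - (?W t \<omega>)\<^sup>2\<bar>)"
      by (rule integral_abs_bound)
    also have "\<dots> \<le> expectation (\<lambda>\<omega>. (?W t \<omega>)\<^sup>2 / sqrt t + (sqrt t + 1) * (2 * C)\<^sup>2)"
      by (rule integral_mono) (intro integrable_abs Bochner_Integration.integrable_diff iV iW
          Bochner_Integration.integrable_add integrable_divide integrable_const key; assumption)+
    also have "\<dots> = ?E t / sqrt t + (sqrt t + 1) * (2 * C)\<^sup>2"
      using iW by (subst Bochner_Integration.integral_add) (simp_all add: prob_space)
    finally show ?thesis .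
  qed
  have s_inf: "filterlim sqrt at_infinity at_top"
    by (rule filterlim_at_top_imp_at_infinity[OF sqrt_at_top])
  have t_inf: "filterlim (\<lambda>t::real. t) at_infinity at_top"
    by (rule filterlim_at_top_imp_at_infinity[OF filterlim_ident])
  have "((\<lambda>t. ?V t / t - ?E t / t) \<longlongrightarrow> 0) at_top"
  proof (rule Lim_null_comparison)
    have "((\<lambda>t. (?E t / t) * (1 / sqrt t) + (1 / sqrt t + 1 / t) * (2 * C)\<^sup>2) \<longlongrightarrow> ?v * 0 + (0 + 0) * (2 * C)\<^sup>2) at_top"
      by (intro tendsto_intros Elim tendsto_divide_0[OF tendsto_const] s_inf t_inf)
    then show "((\<lambda>t. (?E t / t) * (1 / sqrt t) + (1 / sqrt t + 1 / t) * (2 * C)\<^sup>2) \<longlongrightarrow> 0) at_top" by simp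
    show "\<forall>\<^sub>F t in at_top. norm (?V t / t - ?E t / t) \<le> (?E t / t) * (1 / sqrt t) + (1 / sqrt t + 1 / t) * (2 * C)\<^sup>2"
      using eventually_gt_at_top[of 0]
    proof eventually_elim
      case (elim t)
      have "norm (?V t / t - ?E t / t) = \<bar>?V t - ?E t\<bar> / t"
        using elim by (simp add: diff_divide_distrib[symmetric])
      also have "\<dots> \<le> (?E t / sqrt t + (sqrt t + 1) * (2 * C)\<^sup>2) / t"
        using elim by (intro divide_right_mono diff) auto
      also have "\<dots> = (?E t / t) * (1 / sqrt t) + (sqrt t / t + 1 / t) * (2 * C)\<^sup>2"
        by (simp add: add_divide_distrib distrib_right)
      also have "sqrt t / t = 1 / sqrt t" using elim by (simp add: field_simps)
      finally show ?case .
    qed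
  qed
  from tendsto_add[OF this Elim] show ?thesis by simp
qed

end

section \<open>Moments of the thinned count\<close>

context birth_death_process
begin

lemma subalgebra_strict_past: "subalgebra M (strict_past M Q u)"
proof -
  let ?G = "{Q v -` A \<inter> space M |v A. 0 \<le> v \<and> v < u}"
  have "?G \<subseteq> events" using measurable_sets[OF Q_measurable] by auto
  then have "sigma_sets (space M) ?G \<subseteq> events" by (rule sets.sigma_sets_subset)
  moreover have "?G \<subseteq> Pow (space M)" by auto
  ultimately show ?thesis
    unfolding strict_past_def subalgebra_def by simp
qed

lemma Q_measurable_strict_past:
  assumes "0 \<le> v" "v < u"
  shows "Q v \<in> strict_past M Q u \<rightarrow>\<^sub>M count_space UNIV"
proof (rule measurableI)
  fix A :: "nat set"
  let ?G = "{Q v -` A \<inter> space M |v A. 0 \<le> v \<and> v < u}"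
  have "?G \<subseteq> Pow (space M)" by auto
  moreover have "Q v -` A \<inter> space M \<in> ?G" using assms by blast
  ultimately show "Q v -` A \<inter> space (strict_past M Q u) \<in> sets (strict_past M Q u)"
    unfolding strict_past_def by simp
qed simp

text \<open>Conditional expectations given the past are compared with the thinning probabilities only
  for events that have occurred. This is legitimate because the past knows how many there
  are.\<close>

lemma event_count_measurable_strict_past:
  assumes t: "0 < t"
  shows "(\<lambda>\<omega>. event_count (path \<omega>) t) \<in> strict_past M Q (t + 1) \<rightarrow>\<^sub>M count_space UNIV"
proof -
  let ?F = "strict_past M Q (t + 1)" and ?f = "\<lambda>i j. of_bool (j = i + 1 \<or> j + 1 = i) :: real"
  have space: "space ?F = space M" using subalgebra_strict_past by (simp add: subalgebra_def)
  have meas: "(\<lambda>\<omega>. jump_sum ?f (path \<omega>) t) \<in> borel_measurable ?F"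
    by (rule borel_measurable_jump_sum)
      (use t in \<open>auto simp: space intro: Q_measurable_strict_past step_path_Q\<close>)
  have "(\<lambda>\<omega>. event_count (path \<omega>) t) -` {a} \<inter> space ?F \<in> sets ?F" for a
  proof -
    have "(\<lambda>\<omega>. event_count (path \<omega>) t) -` {a} \<inter> space ?F =
        (\<lambda>\<omega>. jump_sum ?f (path \<omega>) t) -` {real a} \<inter> space ?F"
      using event_count_eq_jump_sum[OF step_path_Q] by (auto simp: space simp flip: of_nat_eq_iff[where 'a = real])
    also have "\<dots> \<in> sets ?F" by (rule measurable_sets[OF meas]) simp
    finally show ?thesis .
  qed
  then show ?thesis
    by (subst measurable_count_space_eq2_countable) auto
qed

lemma left_state_le:
  assumes "\<omega> \<in> space M" "0 < s"
  shows "left_state (path \<omega>) s \<le> J"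
proof -
  obtain v where v: "Q v \<omega> = left_state (path \<omega>) s" "0 < v"
    using step_path_left_witness[OF step_path_Q[OF assms(1)] assms(2,2)] by metis
  then show ?thesis using Q_in_S[OF assms(1), of v] by simp
qed

text \<open>The law of total variance for the thinned count, conditionally on the path.\<close>

lemma
  fixes qp qm :: "nat \<Rightarrow> real"
  assumes t: "0 < t" and marks: "thinning_marks M Q qp qm Jp Jm"
    and qp01: "\<And>j. j \<le> J \<Longrightarrow> 0 \<le> qp j \<and> qp j \<le> 1"
    and qm01: "\<And>j. j \<le> J \<Longrightarrow> 0 \<le> qm j \<and> qm j \<le> 1"
  defines "A \<equiv> \<lambda>\<omega>. jump_sum (mark_rate qp qm) (path \<omega>) t"
    and "B \<equiv> \<lambda>\<omega>. jump_sum (\<lambda>i j. (mark_rate qp qm i j)\<^sup>2) (path \<omega>) t"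
  shows expectation_thinned_count: "expectation (thinned_count Q Jp Jm t) = expectation A"
    and variance_thinned_count: "variance (thinned_count Q Jp Jm t) =
      variance A + expectation A - expectation B"
proof -
  let ?F = "strict_past M Q (t + 1)"
  let ?n = "\<lambda>\<omega>. event_count (path \<omega>) t"
  let ?X = "mark_before Q Jp Jm (t + 1)"
  let ?r = "\<lambda>k \<omega>. thinning_prob qp qm (path \<omega>) (event_time (path \<omega>) k)"
  have A_eq: "A \<omega> = (\<Sum>k<?n \<omega>. ?r k \<omega>)" if "\<omega> \<in> space M" for \<omega>
    unfolding A_def using jump_sum_thinning_prob[OF step_path_Q[OF that], of "\<lambda>u. u"] by simp
  have B_eq: "B \<omega> = (\<Sum>k<?n \<omega>. (?r k \<omega>)\<^sup>2)" if "\<omega> \<in> space M" for \<omega>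
    unfolding B_def using jump_sum_thinning_prob[OF step_path_Q[OF that], of "\<lambda>u. u\<^sup>2"] by simp
  have N_eq: "thinned_count Q Jp Jm t \<omega> = (\<Sum>k<?n \<omega>. of_bool (?X k \<omega>))" if "\<omega> \<in> space M" for \<omega>
    by (rule thinned_count_eq_sum_marks[where Q = Q, OF step_path_Q[OF that]])
  have f0: "mark_rate qp qm i i = 0" for i by (simp add: mark_rate_def)
  have iA: "integrable M A" unfolding A_def by (rule integrable_jump_sum[OF t f0])
  have iA2: "integrable M (\<lambda>\<omega>. (A \<omega>)\<^sup>2)" unfolding A_def by (rule integrable_jump_sum_square[OF t f0])
  have iB: "integrable M B" unfolding B_def by (rule integrable_jump_sum[OF t]) (simp add: f0)
  have r01: "\<forall>\<omega>\<in>space M. \<forall>k<?n \<omega>. 0 \<le> ?r k \<omega> \<and> ?r k \<omega> \<le> 1"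
  proof (intro ballI allI impI)
    fix \<omega> k assume that: "\<omega> \<in> space M" "k < ?n \<omega>"
    have "event_time (path \<omega>) k \<in> births (path \<omega>) \<union> deaths (path \<omega>)"
      using bij_betw_event_time[OF step_path_Q[OF that(1)], of t] that(2) unfolding bij_betw_def by blast
    then have "0 < event_time (path \<omega>) k" by (auto simp: births_def deaths_def)
    from left_state_le[OF that(1) this] show "0 \<le> ?r k \<omega> \<and> ?r k \<omega> \<le> 1"
      using qp01 qm01 by (simp add: thinning_prob_def)
  qed
  have t1: "0 < t + 1" using t by simp
  have marks_t: "cond_indep_vars M ?F (\<lambda>_. count_space UNIV) ?X UNIV"
    "AE \<omega> in M. k < card (events_before (path \<omega>) (t + 1)) \<longrightarrow>
      real_cond_exp M ?F (indicator {\<omega> \<in> space M. ?X k \<omega>}) \<omega> = ?r k \<omega>" for k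
    using marks t1 unfolding thinning_marks_def by blast+
  have cond: "AE \<omega> in M. k < ?n \<omega> \<longrightarrow>
      real_cond_exp M ?F (indicator {\<omega> \<in> space M. ?X k \<omega>}) \<omega> = ?r k \<omega>" for k
    using marks_t(2)[of k] AE_space
  proof eventually_elim
    case (elim \<omega>)
    then show ?case using event_count_le[OF step_path_Q, of \<omega> t] by (meson less_le_trans)
  qed
  have n_int: "integrable M (\<lambda>\<omega>. (real (?n \<omega>))\<^sup>2)"
  proof -
    have "integrable M (\<lambda>\<omega>. (jump_sum (\<lambda>i j. of_bool (j = i + 1 \<or> j + 1 = i)) (path \<omega>) t)\<^sup>2)"
      by (rule integrable_jump_sum_square[OF t]) simp
    then show ?thesis
      by (rule Bochner_Integration.integrable_cong[OF refl, THEN iffD1, rotated])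
        (simp add: event_count_eq_jump_sum step_path_Q)
  qed
  have A_meas: "(\<lambda>\<omega>. \<Sum>k<?n \<omega>. ?r k \<omega>) \<in> borel_measurable M"
    using borel_measurable_integrable[OF iA] by (rule measurable_cong[THEN iffD1, rotated]) (rule A_eq)
  have B_meas: "(\<lambda>\<omega>. \<Sum>k<?n \<omega>. (?r k \<omega>)\<^sup>2) \<in> borel_measurable M"
    using borel_measurable_integrable[OF iB] by (rule measurable_cong[THEN iffD1, rotated]) (rule B_eq)
  note moments = bernoulli_sum_moments[OF prob_space_axioms subalgebra_strict_past
      event_count_measurable_strict_past[OF t] marks_t(1) cond r01 n_int A_meas B_meas]
  have iN: "integrable M (thinned_count Q Jp Jm t)"
    using moments(1) by (rule Bochner_Integration.integrable_cong[OF refl, THEN iffD2, rotated]) (rule N_eq)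
  have iN2: "integrable M (\<lambda>\<omega>. (thinned_count Q Jp Jm t \<omega>)\<^sup>2)"
    using moments(2) by (rule Bochner_Integration.integrable_cong[OF refl, THEN iffD2, rotated]) (simp only: N_eq)
  have "expectation (thinned_count Q Jp Jm t) = expectation (\<lambda>\<omega>. \<Sum>k<?n \<omega>. of_bool (?X k \<omega>))"
    by (rule Bochner_Integration.integral_cong[OF refl N_eq])
  also have "\<dots> = expectation (\<lambda>\<omega>. \<Sum>k<?n \<omega>. ?r k \<omega>)" by (rule moments(3))
  also have "\<dots> = expectation A"
    by (rule Bochner_Integration.integral_cong[OF refl A_eq[symmetric]])
  finally show EN: "expectation (thinned_count Q Jp Jm t) = expectation A" .
  have "expectation (\<lambda>\<omega>. (thinned_count Q Jp Jm t \<omega>)\<^sup>2) =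
      expectation (\<lambda>\<omega>. (\<Sum>k<?n \<omega>. of_bool (?X k \<omega>))\<^sup>2)"
    by (rule Bochner_Integration.integral_cong[OF refl]) (simp only: N_eq)
  also have "\<dots> = expectation (\<lambda>\<omega>. (\<Sum>k<?n \<omega>. ?r k \<omega>) + (\<Sum>k<?n \<omega>. ?r k \<omega>)\<^sup>2 - (\<Sum>k<?n \<omega>. (?r k \<omega>)\<^sup>2))"
    by (rule moments(4))
  also have "\<dots> = expectation (\<lambda>\<omega>. A \<omega> + (A \<omega>)\<^sup>2 - B \<omega>)"
    by (rule Bochner_Integration.integral_cong[OF refl]) (simp only: A_eq B_eq)
  also have "\<dots> = expectation A + expectation (\<lambda>\<omega>. (A \<omega>)\<^sup>2) - expectation B"
    using iA iA2 iB by simp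
  finally have EN2: "expectation (\<lambda>\<omega>. (thinned_count Q Jp Jm t \<omega>)\<^sup>2) =
      expectation A + expectation (\<lambda>\<omega>. (A \<omega>)\<^sup>2) - expectation B" .
  show "variance (thinned_count Q Jp Jm t) = variance A + expectation A - expectation B"
  proof -
    have "(expectation (thinned_count Q Jp Jm t))\<^sup>2 = (expectation A)\<^sup>2" by (simp only: EN)
    then show ?thesis
      using variance_eq[OF iN iN2] variance_eq[OF iA iA2] EN2 by linarith
  qed
qed

section \<open>The index of dispersion\<close>

lemma rate_mean_mark_rate: "rate_mean (mark_rate qp qm) = (\<lambda>i. lam i * qp i + mu i * qm i)"
proof
  show "rate_mean (mark_rate qp qm) i = lam i * qp i + mu i * qm i" for i
    using mu_0 by (cases i) (simp_all add: rate_mean_def mark_rate_def)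
qed

lemma rate_mean_mark_rate_square:
  "rate_mean (\<lambda>i j. (mark_rate qp qm i j)\<^sup>2) = (\<lambda>i. lam i * (qp i)\<^sup>2 + mu i * (qm i)\<^sup>2)"
proof
  show "rate_mean (\<lambda>i j. (mark_rate qp qm i j)\<^sup>2) i = lam i * (qp i)\<^sup>2 + mu i * (qm i)\<^sup>2" for i
    using mu_0 by (cases i) (simp_all add: rate_mean_def mark_rate_def)
qed

lemma rate_mean_corrected_mark_rate_square:
  "rate_mean (\<lambda>i j. (corrected (mark_rate qp qm) i j)\<^sup>2) =
    (\<lambda>i. lam i * (qp i + increment (rate_mean (mark_rate qp qm)) i)\<^sup>2 +
      mu i * (qm i - increment (rate_mean (mark_rate qp qm)) (i - 1))\<^sup>2)"
proof
  fix i
  show "rate_mean (\<lambda>i j. (corrected (mark_rate qp qm) i j)\<^sup>2) i =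
      lam i * (qp i + increment (rate_mean (mark_rate qp qm)) i)\<^sup>2 +
      mu i * (qm i - increment (rate_mean (mark_rate qp qm)) (i - 1))\<^sup>2"
    unfolding rate_mean_def[of "\<lambda>i j. (corrected (mark_rate qp qm) i j)\<^sup>2"]
    using mu_0 by (cases i) (simp_all add: corrected_def corrector_Suc mark_rate_def)
qed

lemma thinned_rate_eq_st_mean:
  "thinned_rate J lam mu qp qm st = st_mean (rate_mean (mark_rate qp qm))"
  by (simp add: thinned_rate_def st_mean_def rate_mean_mark_rate)

text \<open>The thinning probabilities vanish where the birth or death rate does, so a positive one
  belongs to a transition that takes place.\<close>

lemma thinned_rate_pos:
  assumes qp: "\<And>j. j \<le> J \<Longrightarrow> 0 \<le> qp j" and qm: "\<And>j. j \<le> J \<Longrightarrow> 0 \<le> qm j"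
    and ends: "qm 0 = 0" "qp J = 0" and ex: "\<exists>j\<le>J. 0 < qp j \<or> 0 < qm j"
  shows "0 < thinned_rate J lam mu qp qm st"
proof -
  have lam0: "0 \<le> lam i" if "i \<le> J" for i using lam_pos[of i] lam_J that by (cases "i = J") auto
  have mu0: "0 \<le> mu i" if "i \<le> J" for i using mu_pos[of i] mu_0 that by (cases "i = 0") auto
  obtain j where j: "j \<le> J" "0 < qp j \<or> 0 < qm j" using ex by blast
  have "0 < lam j * qp j + mu j * qm j"
    using j(2)
  proof
    assume q: "0 < qp j"
    then have "j < J" using j(1) ends by (cases "j = J") auto
    then show ?thesis using q lam_pos[of j] mu0[OF j(1)] qm[OF j(1)] by (intro add_pos_nonneg) auto
  next
    assume q: "0 < qm j"
    then have "0 < j" using ends by (cases j) auto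
    then show ?thesis using q j(1) mu_pos[of j] lam0[OF j(1)] qp[OF j(1)] by (intro add_nonneg_pos) auto
  qed
  then have "0 < st j * (lam j * qp j + mu j * qm j)" using st_pos[OF j(1)] by simp
  moreover have "0 \<le> st i * (lam i * qp i + mu i * qm i)" if "i \<le> J" for i
    using that st_pos[OF that] lam0 mu0 qp qm by (intro mult_nonneg_nonneg add_nonneg_nonneg) auto
  ultimately show ?thesis
    unfolding thinned_rate_def using j(1) by (intro sum_pos2[of _ j]) auto
qed

text \<open>Summing the centred rates up to \<open>k\<close> produces the two cumulative quantities of the
  formula.\<close>

lemma increment_mark_rate:
  assumes L: "thinned_rate J lam mu qp qm st \<noteq> 0"
  shows "increment (rate_mean (mark_rate qp qm)) k =
    thinned_rate J lam mu qp qm st * (cumulative st k - thinned_cumulative J lam mu qp qm st k)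
      / (st k * lam k)"
proof -
  let ?L = "thinned_rate J lam mu qp qm st"
  have "(\<Sum>i\<le>k. st i * (lam i * qp i + mu i * qm i)) =
      (\<Sum>i\<le>k. st i * lam i * qp i) + (\<Sum>i\<le>k. st i * mu i * qm i)"
    by (simp add: distrib_left sum.distrib mult.assoc)
  also have "(\<Sum>i\<le>k. st i * mu i * qm i) = (\<Sum>i=1..k. st i * mu i * qm i)"
    by (rule sum.mono_neutral_right) (use mu_0 in \<open>auto simp: not_less_eq_eq\<close>)
  finally have "(\<Sum>i\<le>k. st i * (lam i * qp i + mu i * qm i)) =
      ?L * thinned_cumulative J lam mu qp qm st k"
    using L by (simp add: thinned_cumulative_def atLeast0AtMost)
  moreover have "(\<Sum>i\<le>k. st i * ?L) = ?L * cumulative st k"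
    by (simp only: cumulative_def sum_distrib_right mult.commute[of ?L])
  ultimately have "(\<Sum>i\<le>k. st i * (?L - (lam i * qp i + mu i * qm i))) =
      ?L * (cumulative st k - thinned_cumulative J lam mu qp qm st k)"
    by (simp only: right_diff_distrib sum_subtractf)
  then show ?thesis
    unfolding increment_def thinned_rate_eq_st_mean[symmetric] unfolding rate_mean_mark_rate by simp
qed

text \<open>On each edge a crossing upwards and a crossing downwards are corrected by the same amount
  with opposite signs, and
  \<open>(a + d)\<^sup>2 + (b - d)\<^sup>2 - a\<^sup>2 - b\<^sup>2 = 2 d (d + a - b)\<close>.\<close>

lemma dispersion_formula:
  assumes L: "0 < thinned_rate J lam mu qp qm st"
  shows "(st_mean (rate_mean (\<lambda>i j. (corrected (mark_rate qp qm) i j)\<^sup>2)) +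
      st_mean (rate_mean (mark_rate qp qm)) - st_mean (rate_mean (\<lambda>i j. (mark_rate qp qm i j)\<^sup>2)))
      / st_mean (rate_mean (mark_rate qp qm)) =
    1 + 2 * (\<Sum>k<J. dispersion_term J lam mu qp qm st k)"
proof -
  let ?L = "thinned_rate J lam mu qp qm st"
  let ?d = "increment (rate_mean (mark_rate qp qm))"
  have "st_mean (rate_mean (\<lambda>i j. (corrected (mark_rate qp qm) i j)\<^sup>2)) -
      st_mean (rate_mean (\<lambda>i j. (mark_rate qp qm i j)\<^sup>2)) =
      (\<Sum>k<J. st k * lam k * ((qp k + ?d k)\<^sup>2 + (qm (Suc k) - ?d k)\<^sup>2)) -
      (\<Sum>k<J. st k * lam k * ((qp k)\<^sup>2 + (qm (Suc k))\<^sup>2))"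
    unfolding rate_mean_corrected_mark_rate_square rate_mean_mark_rate_square st_mean_edges by simp
  also have "\<dots> = (\<Sum>k<J. 2 * ?L * dispersion_term J lam mu qp qm st k)"
    unfolding sum_subtractf[symmetric]
  proof (rule sum.cong[OF refl])
    fix k assume "k \<in> {..<J}"
    then have k: "k < J" by simp
    define w where "w = st k * lam k"
    have w: "w \<noteq> 0" using st_pos[of k] lam_pos[OF k] k by (simp add: w_def)
    define e where "e = cumulative st k - thinned_cumulative J lam mu qp qm st k"
    define d where "d = ?d k"
    have d: "d = ?L * e / w" using increment_mark_rate[of qp qm k] L by (simp add: d_def e_def w_def)
    have wd: "w * d = ?L * e" using w by (simp add: d)
    have "w * ((qp k + d)\<^sup>2 + (qm (Suc k) - d)\<^sup>2) - w * ((qp k)\<^sup>2 + (qm (Suc k))\<^sup>2) =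
        2 * (w * d) * (d + qp k - qm (Suc k))"
      by (simp add: power2_eq_square algebra_simps)
    also have "\<dots> = 2 * ?L * (e * (d + qp k - qm (Suc k)))" by (simp add: wd)
    also have "\<dots> = 2 * ?L * dispersion_term J lam mu qp qm st k"
      by (simp add: dispersion_term_def Let_def d e_def[symmetric] w_def)
    finally show "st k * lam k * ((qp k + ?d k)\<^sup>2 + (qm (Suc k) - ?d k)\<^sup>2) -
        st k * lam k * ((qp k)\<^sup>2 + (qm (Suc k))\<^sup>2) = 2 * ?L * dispersion_term J lam mu qp qm st k"
      by (simp only: d_def w_def)
  qed
  also have "\<dots> = 2 * ?L * (\<Sum>k<J. dispersion_term J lam mu qp qm st k)"
    by (simp only: sum_distrib_left)
  finally have diff: "st_mean (rate_mean (\<lambda>i j. (corrected (mark_rate qp qm) i j)\<^sup>2)) =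
      st_mean (rate_mean (\<lambda>i j. (mark_rate qp qm i j)\<^sup>2)) +
      2 * ?L * (\<Sum>k<J. dispersion_term J lam mu qp qm st k)" by simp
  show ?thesis
    unfolding diff thinned_rate_eq_st_mean[symmetric] using L by (simp add: field_simps)
qed

end

theorem theorem1:
  fixes M :: "'a measure" and J :: nat
    and lam mu qp qm st :: "nat \<Rightarrow> real"
    and p :: "real \<Rightarrow> nat \<Rightarrow> nat \<Rightarrow> real"
    and Q :: "real \<Rightarrow> 'a \<Rightarrow> nat"
    and Jp Jm :: "real \<Rightarrow> 'a \<Rightarrow> bool"
  assumes "0 < J"
    and "lam J = 0" and "mu 0 = 0"
    and "\<And>i. i < J \<Longrightarrow> 0 < lam i"
    and "\<And>i. 0 < i \<Longrightarrow> i \<le> J \<Longrightarrow> 0 < mu i"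
    and "birth_death_chain M J lam mu p Q"
    and "irreducible_chain {..J} p"
    and "\<And>j. j \<le> J \<Longrightarrow> 0 \<le> qp j \<and> qp j \<le> 1"
    and "\<And>j. j \<le> J \<Longrightarrow> 0 \<le> qm j \<and> qm j \<le> 1"
    and "qm 0 = 0" and "qp J = 0"
    and "\<exists>j\<le>J. 0 < qp j \<or> 0 < qm j"
    and "thinning_marks M Q qp qm Jp Jm"
    and "stationary_distribution J lam mu st"
  shows "((\<lambda>t. prob_space.variance M (thinned_count Q Jp Jm t)
             / prob_space.expectation M (thinned_count Q Jp Jm t))
          \<longlongrightarrow> 1 + 2 * (\<Sum>k<J. dispersion_term J lam mu qp qm st k)) at_top"
proof -
  interpret birth_death_process J lam mu st M p Q
    by unfold_locales (fact assms)+
  let ?r = "mark_rate qp qm"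
  let ?A = "\<lambda>t \<omega>. jump_sum ?r (path \<omega>) t"
  let ?B = "\<lambda>t \<omega>. jump_sum (\<lambda>i j. (?r i j)\<^sup>2) (path \<omega>) t"
  have r0: "?r i i = 0" for i by (simp add: mark_rate_def)
  have L: "0 < thinned_rate J lam mu qp qm st"
    by (rule thinned_rate_pos) (use assms in auto)
  have "((\<lambda>t. (variance (?A t) / t + expectation (?A t) / t - expectation (?B t) / t) / (expectation (?A t) / t))
      \<longlongrightarrow> (st_mean (rate_mean (\<lambda>i j. (corrected ?r i j)\<^sup>2)) + st_mean (rate_mean ?r)
        - st_mean (rate_mean (\<lambda>i j. (?r i j)\<^sup>2))) / st_mean (rate_mean ?r)) at_top"
    using L unfolding thinned_rate_eq_st_mean
    by (intro tendsto_divide tendsto_diff tendsto_add variance_jump_sum_asymptotic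
        expectation_jump_sum_asymptotic) (simp_all add: r0)
  then have "((\<lambda>t. (variance (?A t) / t + expectation (?A t) / t - expectation (?B t) / t) / (expectation (?A t) / t))
      \<longlongrightarrow> 1 + 2 * (\<Sum>k<J. dispersion_term J lam mu qp qm st k)) at_top"
    unfolding dispersion_formula[OF L] .
  then show ?thesis
  proof (rule Lim_transform_eventually)
    show "\<forall>\<^sub>F t in at_top. (variance (?A t) / t + expectation (?A t) / t - expectation (?B t) / t) / (expectation (?A t) / t) =
        variance (thinned_count Q Jp Jm t) / expectation (thinned_count Q Jp Jm t)"
      using eventually_gt_at_top[of 0]
    proof eventually_elim
      case (elim t)
      have "variance (thinned_count Q Jp Jm t) = variance (?A t) + expectation (?A t) - expectation (?B t)"
        by (rule variance_thinned_count) (use elim assms in auto)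
      moreover have "expectation (thinned_count Q Jp Jm t) = expectation (?A t)"
        by (rule expectation_thinned_count) (use elim assms in auto)
      ultimately show ?case
        using elim by (simp add: add_divide_distrib[symmetric] diff_divide_distrib[symmetric])
    qed
  qed
qed

end
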